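(* Let $\mathbb{F}=\mathbb{R}$ or $\mathbb{F}=\mathbb{C}$, let $m,n,d$ be positive integers, and let $M(\lambda)=M_0+M_1\lambda+\cdots+M_d\lambda^d\in\mathbb{F}[\lambda]^{m\times(m+n)}_d$ be a minimal basis. Then: (a) If $\operatorname{rank}M_d<m$, then for all $\epsilon>0$ there exists a polynomial matrix $\widetilde M(\lambda)\in\mathbb{F}[\lambda]^{m\times(m+n)}_d$ that is not a minimal basis and satisfies $\|S_1(M)-S_1(\widetilde M)\|_2<\epsilon$. (b) If $\operatorname{rank}M_d=m$, then there exists an index $k$ such that $S_k(M)$ has full row rank, and every polynomial matrix $\widetilde M(\lambda)=\widetilde M_0+\widetilde M_1\lambda+\cdots+\widetilde M_d\lambda^d\in\mathbb{F}[\lambda]^{m\times(m+n)}_d$ that satisfies $$\|S_1(M)-S_1(\widetilde M)\|_2<\frac{\sigma_{(k+d)m}(S_k(M))}{\sqrt{k}}$$ is a minimal basis with $\operatorname{rank}\widetilde M_d=m$.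
   Context: $\mathbb{F}[\lambda]^{m\times(m+n)}_d$ is the $\mathbb{F}$-vector space of $m\times(m+n)$ polynomial matrices of degree at most $d$ (the coefficient of $\lambda^d$ may be zero). Sylvester matrices: for $P(\lambda)=P_0+P_1\lambda+\cdots+P_d\lambda^d\in\mathbb{F}[\lambda]^{m\times(m+n)}_d$ and $k\ge1$, $S_k(P)\in\mathbb{F}^{(k+d)m\times k(m+n)}$ is the block matrix with $k+d$ block rows and $k$ block columns whose $(i,j)$ block is $P_{i-j}$ if $0\le i-j\le d$ and $0$ otherwise. $\sigma_1(A)\ge\sigma_2(A)\ge\cdots\ge\sigma_{\min\{p,q\}}(A)$ are the singular values of $A\in\mathbb{F}^{p\times q}$ and $\|A\|_2=\sigma_1(A)$. A minimal basis of a subspace $\mathcal V\subseteq\mathbb{F}(\lambda)^{q}$ (over $\mathbb{F}(\lambda)$) is a basis of $\mathcal V$ consisting of polynomial vectors whose sum of degrees (degree of a vector = highest degree of its entries) is minimal among all polynomial bases of $\mathcal V$. A polynomial matrix with fewer rows than columns is called a minimal basis if its rows form a minimal basis of the subspace over $\mathbb{F}(\lambda)$ that they span. In (b), the perturbation statement holds for any index $k$ for which $S_k(M)$ has full row rank. *)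

theory Defs
  imports
    "Jordan_Normal_Form.Schur_Decomposition"
    "Jordan_Normal_Form.Char_Poly"
    "Jordan_Normal_Form.DL_Rank"
    "HOL-Computational_Algebra.Polynomial_Factorial"
begin

text \<open>Matrices over \<open>\<F>[\<lambda>]\<close> are of type \<^typ>\<open>'a poly mat\<close>, and the field \<open>\<F>(\<lambda>)\<close> is
  \<^typ>\<open>'a poly fract\<close>.\<close>

subsection \<open>Polynomial matrices and Sylvester matrices\<close>

definition poly_mats :: "nat \<Rightarrow> nat \<Rightarrow> nat \<Rightarrow> 'a::zero poly mat set" where
  "poly_mats r c d = {P \<in> carrier_mat r c. \<forall>i<r. \<forall>j<c. degree (P $$ (i, j)) \<le> d}"

definition coeff_mat :: "'a::zero poly mat \<Rightarrow> nat \<Rightarrow> 'a mat" where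
  "coeff_mat P i = map_mat (\<lambda>p. coeff p i) P"

text \<open>The degree bound \<open>d\<close> is a parameter, since the coefficient of \<open>\<lambda>\<^sup>d\<close> may be zero.\<close>

definition sylvester :: "nat \<Rightarrow> nat \<Rightarrow> 'a::zero poly mat \<Rightarrow> 'a mat" where
  "sylvester d k P =
     (let r = dim_row P; c = dim_col P in
      mat ((k + d) * r) (k * c)
        (\<lambda>(i, j). let a = i div r; b = j div c in
           if b \<le> a \<and> a - b \<le> d then coeff_mat P (a - b) $$ (i mod r, j mod c) else 0))"

subsection \<open>Rank, singular values, spectral norm\<close>

abbreviation mat_rank :: "'a::field mat \<Rightarrow> nat" where
  "mat_rank A \<equiv> vec_space.rank (dim_row A) A"

definition full_row_rank :: "'a::field mat \<Rightarrow> bool" where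
  "full_row_rank A \<longleftrightarrow> mat_rank A = dim_row A"

text \<open>The singular values of a \<open>p \<times> q\<close> matrix \<open>A\<close> in nonincreasing order: the square roots of the
  \<open>min p q\<close> largest eigenvalues of \<open>A A\<^sup>*\<close>, counted with multiplicity (for \<open>p > q\<close> the remaining
  eigenvalues are zero). The eigenvalues are nonnegative reals, so \<^const>\<open>norm\<close> only turns
  them into elements of type \<^typ>\<open>real\<close>.\<close>

definition singular_values :: "'a::{conjugatable_field, real_normed_field} mat \<Rightarrow> real list" where
  "singular_values A =
     take (min (dim_row A) (dim_col A))
       (rev (sorted_list_of_multiset
         (image_mset (\<lambda>x. sqrt (norm x)) (proots (char_poly (A * mat_adjoint A))))))"

text \<open>The numbering of singular values starts at 1.\<close>

definition singular_value :: "nat \<Rightarrow> 'a::{conjugatable_field, real_normed_field} mat \<Rightarrow> real" where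
  "singular_value i A = singular_values A ! (i - 1)"

definition spectral_norm :: "'a::{conjugatable_field, real_normed_field} mat \<Rightarrow> real" where
  "spectral_norm A = singular_value 1 A"

subsection \<open>Minimal bases\<close>

definition vec_degree :: "'a::zero poly vec \<Rightarrow> nat" where
  "vec_degree v = Max (degree ` vec_set v)"

text \<open>Bases are lists without repetition rather than sets, so that a matrix with two equal rows
  is not taken for a basis of its row space.\<close>

definition polynomial_basis ::
    "nat \<Rightarrow> 'a::field poly fract vec set \<Rightarrow> 'a poly vec list \<Rightarrow> bool" where
  "polynomial_basis q V vs \<longleftrightarrow>
     VectorSpace.subspace class_ring V (module_vec TYPE('a poly fract) q) \<and>
     set vs \<subseteq> carrier_vec q \<and> distinct vs \<and>
     vectorspace.basis class_ring ((module_vec TYPE('a poly fract) q)\<lparr>carrier := V\<rparr>)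
       (map_vec to_fract ` set vs)"

definition minimal_basis_of ::
    "nat \<Rightarrow> 'a::field poly fract vec set \<Rightarrow> 'a poly vec list \<Rightarrow> bool" where
  "minimal_basis_of q V vs \<longleftrightarrow>
     polynomial_basis q V vs \<and>
     (\<forall>ws. polynomial_basis q V ws \<longrightarrow>
        sum_list (map vec_degree vs) \<le> sum_list (map vec_degree ws))"

definition rat_row_space :: "'a::field poly mat \<Rightarrow> 'a poly fract vec set" where
  "rat_row_space P =
     LinearCombinations.module.span class_ring (module_vec TYPE('a poly fract) (dim_col P))
       (map_vec to_fract ` set (rows P))"

definition minimal_basis :: "'a::field poly mat \<Rightarrow> bool" where
  "minimal_basis P \<longleftrightarrow>
     dim_row P < dim_col P \<and> minimal_basis_of (dim_col P) (rat_row_space P) (rows P)"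

end

theory Submission
  imports Defs
begin

text \<open>Up to reversal, a left null vector of \<open>S\<^sub>k(M)\<close> is a row \<open>Y\<close> of Laurent series in \<open>1/\<lambda>\<close>, cut
  off after \<open>k + d\<close> terms, such that \<open>Y M\<close> is a polynomial row \<open>w\<^sub>0\<close> plus terms of order below
  \<open>-k\<close>. For \<open>k \<ge> d m\<close> counting dimensions gives a polynomial \<open>r \<noteq> 0\<close> of degree at most \<open>d m\<close> for
  which \<open>r Y\<close> is a polynomial row \<open>v\<close> plus terms of order below \<open>-d\<close>; comparing polynomial
  parts, \<open>v M = r w\<^sub>0\<close> with \<open>deg w\<^sub>0 < d\<close>. If \<open>M\<^sub>d\<close> has full row rank, all rows of \<open>M\<close> have degree
  \<open>d\<close>, so a row \<open>i\<close> with \<open>v\<^sub>i \<noteq> 0\<close> could be replaced by \<open>w\<^sub>0\<close> and \<open>M\<close> would not be minimal. Conversely,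
  a relation \<open>p w = v M\<close> with \<open>w \<noteq> 0\<close> and \<open>deg w < d\<close> makes the expansion of \<open>v / p\<close> a nonzero left
  null vector of every \<open>S\<^sub>k(M)\<close>. Hence full row rank of some \<open>S\<^sub>k(M)\<close> implies minimality, and it survives
  perturbations smaller than the least singular value because \<open>\<parallel>S\<^sub>k(D)\<parallel> \<le> \<surd>k \<parallel>S\<^sub>1(D)\<parallel>\<close>.

  If instead \<open>v M\<^sub>d = 0\<close> for a constant \<open>v \<noteq> 0\<close>, then \<open>v M(t)\<close> has order at most \<open>t\<^sup>d\<^sup>-\<^sup>1\<close>, so a change of
  order \<open>1/t\<close> of one row of \<open>M\<^sub>d\<close> makes \<open>v M(t)\<close> vanish; the quotient of \<open>v M\<close> by \<open>\<lambda> - t\<close>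
  then witnesses non-minimality.\<close>

subsection \<open>Row combinations and rank\<close>

text \<open>There are \<open>r\<close> equations in \<open>r + 1\<close> unknowns. A zero row makes
  the system square, and the resulting singular matrix has a nonzero null vector. Both dimension
  counts below use this form.\<close>

lemma homogeneous_system_nontrivial:
  fixes f :: "nat \<Rightarrow> nat \<Rightarrow> 'a::field"
  shows "\<exists>x. (\<exists>s\<le>r. x s \<noteq> 0) \<and> (\<forall>t<r. (\<Sum>s\<le>r. f t s * x s) = 0)"
proof -
  define A where "A = mat (Suc r) (Suc r) (\<lambda>(t, s). if t < r then f t s else 0)"
  have A: "A \<in> carrier_mat (Suc r) (Suc r)" by (simp add: A_def)
  have "transpose_mat A *\<^sub>v unit_vec (Suc r) r = 0\<^sub>v (Suc r)"
    by (rule eq_vecI) (auto simp: A_def)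
  moreover have "unit_vec (Suc r) r \<noteq> (0\<^sub>v (Suc r) :: 'a vec)"
    by (simp add: unit_vec_nonzero)
  ultimately have "det (transpose_mat A) = 0"
    using det_0_iff_vec_prod_zero[of "transpose_mat A" "Suc r"] A
    by (metis transpose_carrier_mat unit_vec_carrier)
  then have "det A = 0" using det_transpose[OF A] by simp
  then obtain v where v: "v \<in> carrier_vec (Suc r)" "v \<noteq> 0\<^sub>v (Suc r)" "A *\<^sub>v v = 0\<^sub>v (Suc r)"
    using det_0_iff_vec_prod_zero[OF A] by auto
  have "\<exists>s\<le>r. v $ s \<noteq> 0"
    using v(1,2) by (auto intro!: eq_vecI simp: less_Suc_eq_le)
  moreover have "(\<Sum>s\<le>r. f t s * v $ s) = 0" if "t < r" for t
  proof -
    have "(A *\<^sub>v v) $ t = (\<Sum>s\<le>r. f t s * v $ s)"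
      using that v(1) by (auto simp: A_def scalar_prod_def atLeast0LessThan lessThan_Suc_atMost)
    then show ?thesis using v(3) that by simp
  qed
  ultimately show ?thesis by blast
qed

section \<open>Linear combinations of lists of vectors in coordinates\<close>

context vec_space begin

lemma lincomb_list_index:
  assumes "set ws \<subseteq> carrier_vec n" and "j < n"
  shows "lincomb_list c ws $ j = (\<Sum>i<length ws. c i * ws ! i $ j)"
  using assms by (subst lincomb_list_as_mat_mult)
    (auto simp: scalar_prod_def mat_of_cols_def atLeast0LessThan mult.commute intro!: sum.cong)

lemma lincomb_list_eq_iff:
  assumes ws: "set ws \<subseteq> carrier_vec n" and v: "v \<in> carrier_vec n"
  shows "lincomb_list c ws = v \<longleftrightarrow> (\<forall>j<n. (\<Sum>i<length ws. c i * ws ! i $ j) = v $ j)"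
proof -
  have "lincomb_list c ws \<in> carrier_vec n"
    using ws by (intro lincomb_list_carrier) auto
  then show ?thesis
    using v lincomb_list_index[OF ws] by (metis eq_vecI carrier_vecD)
qed

lemma mem_span_set_iff:
  assumes ws: "set ws \<subseteq> carrier_vec n" and v: "v \<in> carrier_vec n"
  shows "v \<in> span (set ws) \<longleftrightarrow> (\<exists>c. \<forall>j<n. (\<Sum>i<length ws. c i * ws ! i $ j) = v $ j)"
  unfolding span_list_as_span[OF ws, symmetric] span_list_def
  by (auto simp: lincomb_list_eq_iff[OF ws v, symmetric])

text \<open>Coefficients are indexed by positions in the list, so two equal vectors already admit
  the nontrivial relation with coefficients \<open>1\<close> and \<open>-1\<close>. This is why
  distinctness joins linear independence on the left.\<close>

lemma distinct_lin_indpt_iff: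
  assumes ws: "set ws \<subseteq> carrier_vec n"
  shows "distinct ws \<and> lin_indpt (set ws) \<longleftrightarrow>
    (\<forall>c. (\<forall>j<n. (\<Sum>i<length ws. c i * ws ! i $ j) = 0) \<longrightarrow> (\<forall>i<length ws. c i = 0))"
    (is "?L \<longleftrightarrow> ?R")
proof (intro iffI)
  assume L: ?L
  show ?R
  proof (intro allI impI)
    fix c i assume c: "\<forall>j<n. (\<Sum>i<length ws. c i * ws ! i $ j) = 0" and i: "i < length ws"
    define a where "a v = c (THE i. i < length ws \<and> ws ! i = v)" for v
    have a: "a (ws ! i) = c i" if "i < length ws" for i
      unfolding a_def using L that
      by (intro arg_cong[of _ _ c] the_equality) (auto simp: nth_eq_iff_index_eq)
    have "lincomb a (set ws) = lincomb_list (\<lambda>i. a (ws ! i)) ws"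
      using L ws by (intro lincomb_as_lincomb_list_distinct) auto
    also have "\<dots> = 0\<^sub>v n"
      using c a by (subst lincomb_list_eq_iff[OF ws]) auto
    finally have "a (ws ! i) = 0"
      using not_lindepD[of "set ws" "set ws" a] L i by auto
    then show "c i = 0" using a i by simp
  qed
next
  assume R: ?R
  have dist: "distinct ws"
  proof (rule ccontr)
    assume "\<not> distinct ws"
    then obtain i k where ik: "i < length ws" "k < length ws" "i \<noteq> k" "ws ! i = ws ! k"
      by (auto simp: distinct_conv_nth)
    define c where "c l = (if l = i then 1 else if l = k then -1 else (0::'a))" for l
    have "(\<Sum>l<length ws. c l * ws ! l $ j) = 0" for j
    proof -
      have "(\<Sum>l<length ws. c l * ws ! l $ j) = (\<Sum>l\<in>{i, k}. c l * ws ! l $ j)"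
        using ik by (intro sum.mono_neutral_right) (auto simp: c_def)
      also have "\<dots> = 0" using ik by (simp add: c_def)
      finally show ?thesis .
    qed
    then have "c i = 0" using R ik by blast
    then show False by (simp add: c_def)
  qed
  moreover have "lin_indpt (set ws)"
  proof (rule finite_lin_indpt2)
    fix a assume "lincomb a (set ws) = 0\<^sub>v n"
    then have "lincomb_list (\<lambda>i. a (ws ! i)) ws = 0\<^sub>v n"
      using dist ws lincomb_as_lincomb_list_distinct by metis
    then have "\<forall>j<n. (\<Sum>i<length ws. a (ws ! i) * ws ! i $ j) = 0"
      using lincomb_list_eq_iff[OF ws, of "0\<^sub>v n"] by simp
    then have "\<forall>i<length ws. a (ws ! i) = 0"
      using R[rule_format, of "\<lambda>i. a (ws ! i)"] by blast
    then show "\<forall>v\<in>set ws. a v = 0" by (metis in_set_conv_nth)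
  qed (use ws in auto)
  ultimately show ?L by blast
qed

end

text \<open>Entry \<open>j\<close> of the product \<open>y A\<close>. The row \<open>y\<close> is a
  function on \<open>nat\<close>, which spares carrier conditions, and the same operation serves
  scalar and polynomial matrices.\<close>

definition row_comb :: "'a::comm_semiring_0 mat \<Rightarrow> (nat \<Rightarrow> 'a) \<Rightarrow> nat \<Rightarrow> 'a" where
  "row_comb A y j = (\<Sum>i<dim_row A. y i * A $$ (i, j))"

text \<open>Triviality of the left kernel. Unlike \<open>mat_rank\<close> it makes sense over a
  ring, so it also expresses independence of the rows of a polynomial matrix without passing to
  fractions.\<close>

definition left_injective :: "'a::comm_semiring_0 mat \<Rightarrow> bool" where
  "left_injective A \<longleftrightarrow>
    (\<forall>y. (\<forall>j<dim_col A. row_comb A y j = 0) \<longrightarrow> (\<forall>i<dim_row A. y i = 0))"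

text \<open>The rank counts a maximal independent set of columns, and such a set spans all columns.
  Hence a row annihilates every column as soon as it annihilates these, and fewer than
  \<open>p\<close> of them always leave a nonzero annihilator.\<close>

lemma mat_rank_eq_dim_row_iff:
  fixes A :: "'a::field mat"
  assumes A: "A \<in> carrier_mat p q"
  shows "mat_rank A = p \<longleftrightarrow> left_injective A" (is "_ \<longleftrightarrow> ?R")
proof -
  interpret vec_space "TYPE('a)" p .
  have dim_A: "dim_row A = p" and len: "length (cols A) = q"
    using A by auto
  have cols: "set (cols A) \<subseteq> carrier_vec p"
    using cols_dim[of A] dim_A by simp
  obtain S where S: "finite S" "maximal S (\<lambda>T. T \<subseteq> set (cols A) \<and> lin_indpt T)"
    using maximal_exists_superset[of "set (cols A)" "\<lambda>T. T \<subseteq> set (cols A) \<and> lin_indpt T" "{}"]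
    by (auto simp: lin_dep_def)
  then have S_cols: "S \<subseteq> set (cols A)" and indpt: "lin_indpt S"
    by (auto simp: maximal_def)
  have S_carrier: "S \<subseteq> carrier_vec p" using S_cols cols by blast
  obtain ws where ws: "set ws = S" "distinct ws" using finite_distinct_list[OF S(1)] by blast
  have ws_carrier: "set ws \<subseteq> carrier_vec p" using ws S_carrier by simp
  have rank: "mat_rank A = length ws"
    using rank_card_indpt[OF A S(2)] dim_A ws distinct_card[of ws] by simp
  have "card S \<le> p"
    using li_le_dim(2)[OF fin_dim _ indpt] S_carrier dim_is_n by simp
  then have le: "length ws \<le> p" using ws distinct_card[of ws] by simp
  have col_span: "v \<in> span (set ws)" if v: "v \<in> set (cols A)" for v
  proof (rule ccontr)
    assume "v \<notin> span (set ws)"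
    moreover have "S \<subseteq> span S" using S_carrier in_own_span by simp
    ultimately have "v \<notin> S" "v \<notin> span S" using ws by auto
    then have "lin_indpt (S \<union> {v})"
      using lin_dep_iff_in_span[of S v] S_carrier indpt v cols by auto
    then show False
      using S(2) S_cols v \<open>v \<notin> S\<close> unfolding maximal_def
      by (metis Un_insert_right insert_subset insertI1 subset_insertI sup_bot_right)
  qed
  have orth: "(\<Sum>j<p. y j * v $ j) = 0"
    if y: "\<And>l. l < length ws \<Longrightarrow> (\<Sum>j<p. y j * ws ! l $ j) = 0" and v: "v \<in> span (set ws)" for y v
  proof -
    have "v \<in> carrier_vec p" using v span_closed ws_carrier by auto
    then obtain c where c: "\<And>j. j < p \<Longrightarrow> (\<Sum>l<length ws. c l * ws ! l $ j) = v $ j"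
      using mem_span_set_iff[OF ws_carrier] v by blast
    have "y j * v $ j = (\<Sum>l<length ws. c l * (y j * ws ! l $ j))" if "j < p" for j
      unfolding c[OF that, symmetric] by (simp add: sum_distrib_left mult.left_commute)
    then have "(\<Sum>j<p. y j * v $ j) = (\<Sum>j<p. \<Sum>l<length ws. c l * (y j * ws ! l $ j))"
      by simp
    also have "\<dots> = (\<Sum>l<length ws. c l * (\<Sum>j<p. y j * ws ! l $ j))"
      by (subst sum.swap) (simp add: sum_distrib_left)
    also have "\<dots> = 0" using y by simp
    finally show ?thesis .
  qed
  show ?thesis
  proof
    assume "mat_rank A = p"
    then have "card S \<ge> dim" using rank ws distinct_card[of ws] dim_is_n by simp
    then have "basis S"
      using dim_li_is_basis[OF fin_dim S(1) _ indpt] S_carrier by simp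
    then have span: "span (set ws) = carrier_vec p" by (simp add: basis_def ws)
    show ?R unfolding left_injective_def
    proof (intro allI impI)
      fix y i assume "\<forall>j<dim_col A. row_comb A y j = 0" and "i < dim_row A"
      then have y: "\<forall>j<q. (\<Sum>i<p. y i * A $$ (i, j)) = 0" and i: "i < p"
        using A by (auto simp: row_comb_def)
      have "(\<Sum>j<p. y j * ws ! l $ j) = 0" if "l < length ws" for l
      proof -
        have "ws ! l \<in> set (cols A)" using that S_cols ws by (metis nth_mem subsetD)
        then obtain j where "j < q" "ws ! l = col A j"
          using A len by (metis in_set_conv_nth cols_nth cols_length)
        moreover have "(\<Sum>i<p. y i * col A j $ i) = (\<Sum>i<p. y i * A $$ (i, j))"
          using A \<open>j < q\<close> by (intro sum.cong) auto
        ultimately show ?thesis using y by simp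
      qed
      from orth[OF this, of "unit_vec p i"] have "(\<Sum>j<p. y j * unit_vec p i $ j) = 0"
        by (simp add: span)
      also have "(\<Sum>j<p. y j * unit_vec p i $ j) = (\<Sum>j<p. if j = i then y i else 0)"
        using i by (intro sum.cong) (auto simp: unit_vec_def)
      finally show "y i = 0" using i by simp
    qed
  next
    assume R: ?R
    show "mat_rank A = p"
    proof (rule ccontr)
      assume "mat_rank A \<noteq> p"
      then have lt: "length ws < p" using le rank by simp
      \<comment> \<open>The fewer than \<open>p\<close> chosen columns impose at most
        \<open>p - 1\<close> conditions on the \<open>p\<close> entries of \<open>y\<close>; missing
        conditions are filled up with zero equations.\<close>
      obtain y where y: "\<exists>s\<le>p - 1. y s \<noteq> 0"
        "\<forall>t<p - 1. (\<Sum>s\<le>p - 1. (if t < length ws then ws ! t $ s else 0) * y s) = 0"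
        using homogeneous_system_nontrivial[of "p - 1" "\<lambda>t s. if t < length ws then ws ! t $ s else 0"]
        by blast
      have atMost: "{..p - Suc 0} = {..<p}" using lt by auto
      have "(\<Sum>j<p. y j * ws ! l $ j) = 0" if "l < length ws" for l
      proof -
        have "l < p - 1" using that lt by simp
        then show ?thesis using y(2)[rule_format, of l] that by (simp add: atMost mult.commute)
      qed
      note y_orth = orth[OF this]
      have "(\<Sum>i<p. y i * A $$ (i, j)) = 0" if "j < q" for j
      proof -
        have "col A j \<in> set (cols A)" using that A by (auto simp: cols_def)
        then have "(\<Sum>i<p. y i * col A j $ i) = 0" using y_orth col_span by blast
        moreover have "(\<Sum>i<p. y i * col A j $ i) = (\<Sum>i<p. y i * A $$ (i, j))"
          using A that by (intro sum.cong) auto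
        ultimately show ?thesis by simp
      qed
      then have "\<forall>j<dim_col A. row_comb A y j = 0" using A by (simp add: row_comb_def)
      then have "\<forall>i<p. y i = 0" using R A by (auto simp: left_injective_def)
      moreover have "s < p" if "s \<le> p - 1" for s using that lt by simp
      ultimately show False using y(1) by blast
    qed
  qed
qed

subsection \<open>Bases of the rational row space\<close>

text \<open>Used to turn relations over the rational functions into polynomial ones. The induction
  multiplies the previous denominator by that of the new coefficient.\<close>

lemma common_denominator:
  fixes c :: "nat \<Rightarrow> 'a::field poly fract"
  shows "\<exists>p v. p \<noteq> 0 \<and> (\<forall>i<m. to_fract p * c i = to_fract (v i))"
proof (induction m)
  case 0
  show ?case by (intro exI[of _ 1]) auto
next
  case (Suc m)
  then obtain p v where p: "p \<noteq> 0" "\<forall>i<m. to_fract p * c i = to_fract (v i)" by blast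
  obtain a b where ab: "b \<noteq> 0" "c m = Fract a b" by (cases "c m") auto
  have cm: "to_fract b * c m = to_fract a"
    using ab by (simp add: to_fract_def eq_fract)
  define v' where "v' i = (if i < m then b * v i else p * a)" for i
  have "to_fract (p * b) * c i = to_fract (v' i)" if "i < Suc m" for i
  proof (cases "i = m")
    case True
    then show ?thesis using cm by (simp add: v'_def mult.assoc)
  next
    case False
    then have "to_fract (p * b) * c i = to_fract b * (to_fract p * c i)" by (simp add: mult_ac)
    then show ?thesis using p(2) that False by (simp add: v'_def)
  qed
  moreover have "p * b \<noteq> 0" using p ab by simp
  ultimately show ?case by blast
qed

lemma map_vec_to_fract_eq_iff:
  "map_vec to_fract v = map_vec to_fract (w :: 'a::field poly vec) \<longleftrightarrow> v = w"
  by (auto simp: vec_eq_iff)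

text \<open>\<open>polynomial_basis\<close> speaks about the vector space with carrier
  \<open>V\<close>. Span and independence computed there agree with those of the ambient space once
  the vectors lie in \<open>V\<close>, and both sides fail otherwise.\<close>

lemma polynomial_basis_iff:
  fixes ps :: "'a::field poly vec list"
  defines "fs \<equiv> map (map_vec to_fract) ps"
  assumes V: "VectorSpace.subspace class_ring V (module_vec TYPE('a poly fract) q)"
    and ps: "set ps \<subseteq> carrier_vec q"
  shows "polynomial_basis q V ps \<longleftrightarrow> distinct fs \<and>
    \<not> LinearCombinations.module.lin_dep class_ring (module_vec TYPE('a poly fract) q) (set fs) \<and>
    LinearCombinations.module.span class_ring (module_vec TYPE('a poly fract) q) (set fs) = V"
proof -
  interpret vec_space "TYPE('a poly fract)" q .
  interpret W: vectorspace class_ring "vs V"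
    using V by (rule subspace_is_vs)
  have sub: "submodule class_ring V (module_vec TYPE('a poly fract) q)" using V by simp
  have dist: "distinct fs \<longleftrightarrow> distinct ps"
    unfolding fs_def distinct_map by (auto simp: inj_on_def map_vec_to_fract_eq_iff)
  have fs: "set fs = map_vec to_fract ` set ps" by (simp add: fs_def)
  show ?thesis
  proof (cases "set fs \<subseteq> V")
    case True
    show ?thesis
      unfolding polynomial_basis_def W.basis_def dist fs[symmetric]
      using span_li_not_depend[OF True sub] V ps True by auto
  next
    case False
    moreover have "set fs \<subseteq> span (set fs)"
      using ps by (intro in_own_span) (auto simp: fs_def)
    ultimately show ?thesis
      unfolding polynomial_basis_def W.basis_def fs[symmetric] by auto
  qed
qed

lemma rows_subset_carrier: "A \<in> carrier_mat m q \<Longrightarrow> set (rows A) \<subseteq> carrier_vec q"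
  using rows_carrier[of A] by auto

lemma fract_rows_lin_indpt_iff:
  fixes M :: "'a::field poly mat"
  defines "fs \<equiv> map (map_vec to_fract) (rows M)"
  assumes M: "M \<in> carrier_mat m q"
  shows "distinct fs \<and>
      \<not> LinearCombinations.module.lin_dep class_ring (module_vec TYPE('a poly fract) q) (set fs)
    \<longleftrightarrow> left_injective M"
proof -
  interpret vec_space "TYPE('a poly fract)" q .
  have fs: "set fs \<subseteq> carrier_vec q" "length fs = m"
    using M rows_subset_carrier[OF M] by (auto simp: fs_def)
  have fs_nth: "fs ! i $ j = to_fract (M $$ (i, j))" if "i < m" "j < q" for i j
    using that M by (simp add: fs_def)
  have "(\<forall>c. (\<forall>j<q. (\<Sum>i<length fs. c i * fs ! i $ j) = 0) \<longrightarrow> (\<forall>i<length fs. c i = 0))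
    \<longleftrightarrow> left_injective M" (is "?L \<longleftrightarrow> _")
  proof
    assume L: ?L
    show "left_injective M" unfolding left_injective_def
    proof (intro allI impI)
      fix y i assume y: "\<forall>j<dim_col M. row_comb M y j = 0" and i: "i < dim_row M"
      have "(\<Sum>i<length fs. to_fract (y i) * fs ! i $ j) = to_fract (row_comb M y j)" if "j < q" for j
        using that fs M fs_nth by (auto simp: row_comb_def intro!: sum.cong)
      then have "\<forall>j<q. (\<Sum>i<length fs. to_fract (y i) * fs ! i $ j) = 0"
        using y M by simp
      moreover have "i < length fs" using i M fs by simp
      ultimately have "to_fract (y i) = 0"
        using L[THEN spec, of "\<lambda>i. to_fract (y i)"] by blast
      then show "y i = 0" by simp
    qed
  next
    assume R: "left_injective M"
    show ?L
    proof (intro allI impI)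
      fix c i assume c: "\<forall>j<q. (\<Sum>i<length fs. c i * fs ! i $ j) = 0" and i: "i < length fs"
      obtain p v where p: "p \<noteq> 0" "\<And>i. i < m \<Longrightarrow> to_fract p * c i = to_fract (v i)"
        using common_denominator[of m c] by blast
      have "to_fract (row_comb M v j) = 0" if j: "j < q" for j
      proof -
        have "to_fract (row_comb M v j) = (\<Sum>i<m. to_fract (v i) * fs ! i $ j)"
          using j M fs_nth by (auto simp: row_comb_def intro!: sum.cong)
        also have "\<dots> = (\<Sum>i<m. to_fract p * (c i * fs ! i $ j))"
          by (intro sum.cong refl) (metis p(2) lessThan_iff mult.assoc)
        also have "\<dots> = to_fract p * (\<Sum>i<length fs. c i * fs ! i $ j)"
          unfolding fs(2) by (simp add: sum_distrib_left)
        finally show ?thesis using c j by simp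
      qed
      then have "v i = 0" using R M i fs by (auto simp: left_injective_def)
      then show "c i = 0" using p i fs by (metis mult_eq_0_iff to_fract_eq_0_iff)
    qed
  qed
  then show ?thesis using distinct_lin_indpt_iff[OF fs(1)] by simp
qed

lemma polynomial_basis_rows_iff:
  fixes M :: "'a::field poly mat"
  assumes M: "M \<in> carrier_mat m q"
  shows "polynomial_basis q (rat_row_space M) (rows M) \<longleftrightarrow> left_injective M"
proof -
  interpret vec_space "TYPE('a poly fract)" q .
  define fs where "fs = map (map_vec to_fract) (rows M)"
  note rows = rows_subset_carrier[OF M]
  have fs: "set fs \<subseteq> carrier_vec q" using rows by (auto simp: fs_def)
  have V: "rat_row_space M = span (set fs)"
    unfolding rat_row_space_def fs_def using M by simp
  have sub: "VectorSpace.subspace class_ring (rat_row_space M) (module_vec TYPE('a poly fract) q)"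
    unfolding V using fs span_is_subspace by simp
  have "polynomial_basis q (rat_row_space M) (rows M) \<longleftrightarrow> distinct fs \<and> lin_indpt (set fs)"
    using polynomial_basis_iff[OF sub rows] unfolding fs_def[symmetric] V by simp
  also have "\<dots> \<longleftrightarrow> left_injective M"
    unfolding fs_def using fract_rows_lin_indpt_iff[OF M] .
  finally show ?thesis .
qed

text \<open>Writing the rational coefficients as \<open>v i / p\<close> with a common denominator
  describes membership by polynomials alone. The relations \<open>p w = v M\<close> below stand for
  this.\<close>

lemma rat_row_space_iff:
  fixes M :: "'a::field poly mat"
  assumes M: "M \<in> carrier_mat m q" and w: "w \<in> carrier_vec q"
  shows "map_vec to_fract w \<in> rat_row_space M \<longleftrightarrow>
    (\<exists>p v. p \<noteq> 0 \<and> (\<forall>j<q. p * w $ j = row_comb M v j))"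
proof -
  interpret vec_space "TYPE('a poly fract)" q .
  define fs where "fs = map (map_vec to_fract) (rows M)"
  have fs: "set fs \<subseteq> carrier_vec q" "length fs = m"
    using M rows_subset_carrier[OF M] by (auto simp: fs_def)
  have fs_nth: "fs ! i $ j = to_fract (M $$ (i, j))" if "i < m" "j < q" for i j
    using that M by (simp add: fs_def)
  have V: "rat_row_space M = span (set fs)"
    unfolding rat_row_space_def fs_def using M by simp
  have comb: "to_fract (row_comb M v j) = (\<Sum>i<m. to_fract (v i) * fs ! i $ j)" if "j < q" for v j
    using that M fs_nth by (auto simp: row_comb_def intro!: sum.cong)
  have mem: "map_vec to_fract w \<in> rat_row_space M \<longleftrightarrow>
      (\<exists>c. \<forall>j<q. (\<Sum>i<m. c i * fs ! i $ j) = to_fract (w $ j))"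
    unfolding V using mem_span_set_iff[OF fs(1), of "map_vec to_fract w"] w fs(2) by simp
  show ?thesis unfolding mem
  proof
    assume "\<exists>c. \<forall>j<q. (\<Sum>i<m. c i * fs ! i $ j) = to_fract (w $ j)"
    then obtain c where c: "\<forall>j<q. (\<Sum>i<m. c i * fs ! i $ j) = to_fract (w $ j)" by blast
    obtain p v where p: "p \<noteq> 0" "\<And>i. i < m \<Longrightarrow> to_fract p * c i = to_fract (v i)"
      using common_denominator by blast
    have "p * w $ j = row_comb M v j" if j: "j < q" for j
    proof -
      have "to_fract (p * w $ j) = (\<Sum>i<m. to_fract p * c i * fs ! i $ j)"
        using c[rule_format, OF j, symmetric] by (simp add: sum_distrib_left mult.assoc)
      also have "\<dots> = to_fract (row_comb M v j)" using p(2) comb[OF j] by simp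
      finally show ?thesis by (simp only: to_fract_eq_iff)
    qed
    then show "\<exists>p v. p \<noteq> 0 \<and> (\<forall>j<q. p * w $ j = row_comb M v j)" using p by blast
  next
    assume "\<exists>p v. p \<noteq> 0 \<and> (\<forall>j<q. p * w $ j = row_comb M v j)"
    then obtain p v where p: "p \<noteq> 0" "\<forall>j<q. p * w $ j = row_comb M v j" by blast
    have "(\<Sum>i<m. to_fract (v i) / to_fract p * fs ! i $ j) = to_fract (w $ j)" if j: "j < q" for j
    proof -
      have "(\<Sum>i<m. to_fract (v i) / to_fract p * fs ! i $ j) = to_fract (p * w $ j) / to_fract p"
        using p(2) j comb[OF j] by (simp add: sum_divide_distrib)
      then show ?thesis using p(1) by simp
    qed
    then show "\<exists>c. \<forall>j<q. (\<Sum>i<m. c i * fs ! i $ j) = to_fract (w $ j)"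
      by (intro exI[of _ "\<lambda>i. to_fract (v i) / to_fract p"]) auto
  qed
qed

text \<open>The exchange step: since \<open>v i\<close> is nonzero, the relation
  \<open>p w = v M\<close> can be solved for row \<open>i\<close>, so \<open>w\<close> and the other
  rows have the same rational span and stay independent.\<close>

lemma polynomial_basis_update_row:
  fixes M :: "'a::field poly mat"
  assumes M: "M \<in> carrier_mat m q" and inj: "left_injective M" and i: "i < m"
    and w: "w \<in> carrier_vec q" and p: "p \<noteq> 0" and v: "v i \<noteq> 0"
    and pw: "\<And>j. j < q \<Longrightarrow> p * w $ j = row_comb M v j"
  shows "polynomial_basis q (rat_row_space M) ((rows M)[i := w])"
proof -
  define W where "W = mat_of_rows q ((rows M)[i := w])"
  have set_upd: "set ((rows M)[i := w]) \<subseteq> carrier_vec q"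
    using set_update_subset_insert[of "rows M" i w] rows_subset_carrier[OF M] w by blast
  have W: "W \<in> carrier_mat m q" and rows_W: "rows W = (rows M)[i := w]"
    using M set_upd by (auto simp: W_def rows_mat_of_rows)
  have W_nth: "W $$ (l, j) = (if l = i then w $ j else M $$ (l, j))" if "l < m" "j < q" for l j
    using that M by (auto simp: W_def mat_of_rows_def nth_list_update)
  have comb_W: "row_comb W y j = row_comb M (y(i := 0)) j + y i * w $ j" if "j < q" for y j
  proof -
    have "row_comb W y j = y i * W $$ (i, j) + (\<Sum>l\<in>{..<m} - {i}. y l * W $$ (l, j))"
      using W i by (simp add: row_comb_def sum.remove[of _ i])
    also have "(\<Sum>l\<in>{..<m} - {i}. y l * W $$ (l, j)) = (\<Sum>l\<in>{..<m} - {i}. (y(i := 0)) l * M $$ (l, j))"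
      using that by (intro sum.cong) (auto simp: W_nth)
    also have "\<dots> = row_comb M (y(i := 0)) j"
      using M i by (simp add: row_comb_def sum.remove[of _ i])
    finally show ?thesis using i that by (simp add: W_nth)
  qed
  \<comment> \<open>With \<open>z = y i\<close> this multiplies a relation among the rows of
    \<open>W\<close> by \<open>p\<close> and replaces \<open>p w\<close> by \<open>v M\<close>,
    which leaves a relation among the rows of \<open>M\<close>.\<close>
  have comb_add: "p * row_comb M y j + z * row_comb M v j = row_comb M (\<lambda>l. p * y l + z * v l) j"
    for y z j
    unfolding row_comb_def sum_distrib_left sum.distrib[symmetric]
    by (intro sum.cong) (auto simp: algebra_simps)
  have inj_W: "left_injective W" unfolding left_injective_def
  proof (intro allI impI)
    fix y l assume y: "\<forall>j<dim_col W. row_comb W y j = 0" and l: "l < dim_row W"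
    have "row_comb M (\<lambda>l. p * (y(i := 0)) l + y i * v l) j = 0" if "j < q" for j
    proof -
      have "0 = p * row_comb W y j" using y W that by simp
      also have "\<dots> = p * row_comb M (y(i := 0)) j + y i * (p * w $ j)"
        using comb_W[OF that] by (simp add: algebra_simps)
      finally show ?thesis using pw[OF that] comb_add[of "y(i := 0)" j "y i"] by simp
    qed
    then have zero: "p * (y(i := 0)) l + y i * v l = 0" if "l < m" for l
      using inj[unfolded left_injective_def, rule_format, of "\<lambda>l. p * (y(i := 0)) l + y i * v l" l] M that
      by simp
    have "y i = 0" using zero[OF i] v by simp
    then show "y l = 0" using zero[of l] l W p by (cases "l = i") auto
  qed
  interpret vec_space "TYPE('a poly fract)" q .
  define fs where "fs = map (map_vec to_fract) (rows M)"
  define gs where "gs = map (map_vec to_fract) (rows W)"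
  have fs: "set fs \<subseteq> carrier_vec q" and gs: "set gs \<subseteq> carrier_vec q"
    using rows_subset_carrier[OF M] rows_subset_carrier[OF W] by (auto simp: fs_def gs_def)
  have V: "rat_row_space M = span (set fs)" "rat_row_space W = span (set gs)"
    unfolding rat_row_space_def fs_def gs_def using M W by simp_all
  have sub: "VectorSpace.subspace class_ring (span (set fs)) (module_vec TYPE('a poly fract) q)"
    "VectorSpace.subspace class_ring (span (set gs)) (module_vec TYPE('a poly fract) q)"
    using fs gs span_is_subspace by simp_all
  have "set gs \<subseteq> span (set fs)"
  proof -
    have "map_vec to_fract w \<in> span (set fs)"
      unfolding V[symmetric] rat_row_space_iff[OF M w] using p pw by blast
    moreover have "set gs \<subseteq> insert (map_vec to_fract w) (set fs)"
      unfolding gs_def fs_def rows_W using set_update_subset_insert[of "rows M" i w] by auto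
    moreover have "set fs \<subseteq> span (set fs)" using fs in_own_span by simp
    ultimately show ?thesis by blast
  qed
  moreover have "set fs \<subseteq> span (set gs)"
  proof
    fix f assume "f \<in> set fs"
    then obtain l where l: "l < m" "f = map_vec to_fract (row M l)"
      using M by (auto simp: fs_def rows_def)
    show "f \<in> span (set gs)"
    proof (cases "l = i")
      case False
      then have "f = map_vec to_fract (row W l)"
        using l M W by (auto simp: W_nth)
      then have "f \<in> set gs" using l W by (auto simp: gs_def rows_def)
      then show ?thesis using gs in_own_span by auto
    next
      case True
      have "v i * row M i $ j = row_comb W (\<lambda>l. if l = i then p else - v l) j" if "j < q" for j
      proof -
        have "row_comb M ((\<lambda>l. if l = i then p else - v l)(i := 0)) j = - row_comb M (v(i := 0)) j"
          unfolding row_comb_def sum_negf[symmetric] by (intro sum.cong) auto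
        then have "row_comb W (\<lambda>l. if l = i then p else - v l) j = row_comb M v j - row_comb M (v(i := 0)) j"
          using comb_W[OF that] pw[OF that] by simp
        also have "\<dots> = v i * M $$ (i, j)"
          using M i by (simp add: row_comb_def sum.remove[of _ i])
        finally show ?thesis using M i that by simp
      qed
      then have "map_vec to_fract (row M i) \<in> span (set gs)"
        unfolding V(2)[symmetric] using v M i
        by (subst rat_row_space_iff[OF W]) (auto intro!: exI[of _ "v i"])
      then show ?thesis using True l by simp
    qed
  qed
  ultimately have "span (set gs) = span (set fs)"
    using span_is_subset[OF _ is_module[OF sub(1)]] span_is_subset[OF _ is_module[OF sub(2)]] by blast
  moreover have "distinct gs \<and> lin_indpt (set gs)"
    unfolding gs_def using fract_rows_lin_indpt_iff[OF W] inj_W by blast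
  ultimately show ?thesis
    using polynomial_basis_iff[OF sub(1), of "rows W"] set_upd
    unfolding V gs_def[symmetric] rows_W[symmetric] by simp
qed

section \<open>Row degrees and criteria for minimality\<close>

lemma degree_le_vec_degree: "j < dim_vec v \<Longrightarrow> degree (v $ j) \<le> vec_degree v"
  unfolding vec_degree_def by (intro Max_ge) (auto simp: vec_set_def)

lemma vec_degree_attained:
  assumes "0 < dim_vec v"
  shows "\<exists>j<dim_vec v. degree (v $ j) = vec_degree v"
proof -
  have "vec_degree v \<in> degree ` vec_set v"
    unfolding vec_degree_def using assms by (intro Max_in) (auto simp: vec_set_def)
  then show ?thesis by (auto simp: vec_set_def)
qed

lemma polynomial_basis_length:
  fixes ps qs :: "'a::field poly vec list"
  assumes ps: "polynomial_basis q V ps" and qs: "polynomial_basis q V qs"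
  shows "length ps = length qs"
proof -
  interpret vec_space "TYPE('a poly fract)" q .
  interpret W: vectorspace class_ring "vs V"
    using ps unfolding polynomial_basis_def by (intro subspace_is_vs) simp
  have "length us = W.dim" if "polynomial_basis q V us" for us
  proof -
    have "W.basis (map_vec to_fract ` set us)" "distinct us"
      using that by (auto simp: polynomial_basis_def)
    moreover have "card (map_vec to_fract ` set us) = length us"
      using \<open>distinct us\<close> by (subst card_image)
        (auto simp: inj_on_def map_vec_to_fract_eq_iff distinct_card)
    ultimately show ?thesis using W.dim_basis[of "map_vec to_fract ` set us"] by simp
  qed
  then show ?thesis using ps qs by metis
qed

lemma minimal_basis_carrier_iff:
  assumes "M \<in> carrier_mat m q"
  shows "minimal_basis M \<longleftrightarrow> m < q \<and> left_injective M \<and>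
    (\<forall>ws. polynomial_basis q (rat_row_space M) ws \<longrightarrow>
        sum_list (map vec_degree (rows M)) \<le> sum_list (map vec_degree ws))"
  unfolding minimal_basis_def minimal_basis_of_def
  using polynomial_basis_rows_iff[OF assms] assms by auto

text \<open>A vector of smaller degree that involves row \<open>i\<close> could replace it.\<close>

lemma minimal_basis_row_degree_le:
  fixes M :: "'a::field poly mat"
  assumes M: "M \<in> carrier_mat m q" and min: "minimal_basis M"
    and i: "i < m" and p: "p \<noteq> 0" and v: "v i \<noteq> 0"
    and pw: "\<And>j. j < q \<Longrightarrow> p * w j = row_comb M v j"
  shows "\<exists>j<q. w j \<noteq> 0 \<and> vec_degree (row M i) \<le> degree (w j)"
proof -
  have inj: "left_injective M" and q: "m < q" and
    sum_le: "\<And>ws. polynomial_basis q (rat_row_space M) ws \<Longrightarrow>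
      sum_list (map vec_degree (rows M)) \<le> sum_list (map vec_degree ws)"
    using min minimal_basis_carrier_iff[OF M] by auto
  \<comment> \<open>The zero polynomial has \<open>degree\<close> 0, so a nonzero entry has to be
    secured before degrees are compared.\<close>
  have "\<exists>j<q. w j \<noteq> 0"
  proof (rule ccontr)
    assume "\<not> (\<exists>j<q. w j \<noteq> 0)"
    then have "\<forall>j<q. row_comb M v j = 0" using pw by simp
    then have "v i = 0" using inj M i unfolding left_injective_def by blast
    then show False using v by simp
  qed
  then obtain j0 where j0: "j0 < q" "w j0 \<noteq> 0" by blast
  define ws where "ws = (rows M)[i := vec q w]"
  have "polynomial_basis q (rat_row_space M) ws"
    unfolding ws_def using polynomial_basis_update_row[OF M inj i, of "vec q w" p v] p v pw by simp
  then have "sum_list (map vec_degree (rows M)) \<le> sum_list (map vec_degree ws)"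
    by (rule sum_le)
  also have "map vec_degree ws = (map vec_degree (rows M))[i := vec_degree (vec q w)]"
    by (simp add: ws_def map_update)
  also have "sum_list \<dots> = sum_list (map vec_degree (rows M)) + vec_degree (vec q w) - vec_degree (row M i)"
    using i M by (subst sum_list_update) auto
  finally have le: "vec_degree (row M i) \<le> vec_degree (vec q w)"
    using member_le_sum_list[of "vec_degree (row M i)" "map vec_degree (rows M)"] i M
    by (auto simp: rows_def)
  obtain j where j: "j < q" "degree (w j) = vec_degree (vec q w)"
    using vec_degree_attained[of "vec q w"] q by auto
  show ?thesis
  proof (cases "w j = 0")
    \<comment> \<open>The degree is attained at a zero entry only if it is 0; then any nonzero entry
      will do.\<close>
    case True
    then have "vec_degree (row M i) \<le> degree (w j0)" using le j by simp
    then show ?thesis using j0 by blast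
  next
    case False
    then show ?thesis using j le by auto
  qed
qed

text \<open>All polynomial bases of the row space have \<open>m\<close> elements. If no nonzero
  polynomial vector of the space has degree below \<open>d\<close>, each basis has degree sum at
  least \<open>m d\<close>, whereas the rows of \<open>M\<close> reach at most
  \<open>m d\<close>.\<close>

lemma minimal_basisI:
  fixes M :: "'a::field poly mat"
  assumes M: "M \<in> poly_mats m q d" and q: "m < q" and inj: "left_injective M"
    and deg: "\<And>p v w. p \<noteq> 0 \<Longrightarrow> (\<And>j. j < q \<Longrightarrow> p * w j = row_comb M v j) \<Longrightarrow>
      (\<And>j. j < q \<Longrightarrow> degree (w j) < d) \<Longrightarrow> (\<And>j. j < q \<Longrightarrow> w j = 0)"
  shows "minimal_basis M"
proof -
  have Mc: "M \<in> carrier_mat m q" and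
    M_deg: "\<And>i j. i < m \<Longrightarrow> j < q \<Longrightarrow> degree (M $$ (i, j)) \<le> d"
    using M by (auto simp: poly_mats_def)
  interpret vec_space "TYPE('a poly fract)" q .
  have "sum_list (map vec_degree (rows M)) \<le> sum_list (map vec_degree ws)"
    if ws: "polynomial_basis q (rat_row_space M) ws" for ws
  proof -
    have sub: "VectorSpace.subspace class_ring (rat_row_space M) (module_vec TYPE('a poly fract) q)"
      and ws_carrier: "set ws \<subseteq> carrier_vec q"
      using ws unfolding polynomial_basis_def by auto
    define fs where "fs = map (map_vec to_fract) ws"
    have fs: "set fs \<subseteq> carrier_vec q" using ws_carrier by (auto simp: fs_def)
    have indpt: "lin_indpt (set fs)" and span: "span (set fs) = rat_row_space M"
      using ws unfolding polynomial_basis_iff[OF sub ws_carrier] fs_def by blast+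
    have "length ws = m"
      using polynomial_basis_length[OF ws] polynomial_basis_rows_iff[OF Mc] inj Mc by simp
    have "d \<le> vec_degree w" if w: "w \<in> set ws" for w
    proof (rule ccontr)
      assume lt: "\<not> d \<le> vec_degree w"
      have wc: "w \<in> carrier_vec q" using w ws_carrier by blast
      have w_fs: "map_vec to_fract w \<in> set fs" using w by (simp add: fs_def)
      then have "map_vec to_fract w \<in> rat_row_space M" using span in_own_span[of "set fs"] fs by auto
      then obtain p v where pv: "p \<noteq> 0" "\<And>j. j < q \<Longrightarrow> p * w $ j = row_comb M v j"
        using rat_row_space_iff[OF Mc wc] by blast
      have "degree (w $ j) < d" if "j < q" for j
        using degree_le_vec_degree[of j w] lt that wc by simp
      then have "w $ j = 0" if "j < q" for j
        using deg[of p "\<lambda>j. w $ j" v j] pv that by blast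
      then have "map_vec to_fract w = 0\<^sub>v q" using wc by (intro eq_vecI) auto
      moreover have "0\<^sub>v q \<notin> set fs" using vs_zero_lin_dep[OF _ indpt] fs by simp
      ultimately show False using w_fs by simp
    qed
    then have "sum_list (map (\<lambda>_. d) ws) \<le> sum_list (map vec_degree ws)"
      by (intro sum_list_mono) auto
    moreover have "vec_degree r \<le> d" if "r \<in> set (rows M)" for r
    proof -
      from that obtain i where i: "i < length (rows M)" "rows M ! i = r"
        unfolding in_set_conv_nth by blast
      then have "i < m" "r = row M i" using Mc by auto
      moreover from this have "dim_vec r = q" using Mc by simp
      then obtain j where "j < q" "degree (r $ j) = vec_degree r"
        using vec_degree_attained[of r] q by auto
      ultimately show ?thesis using M_deg[of i j] Mc by simp
    qed
    then have "sum_list (map vec_degree (rows M)) \<le> sum_list (map (\<lambda>_. d) (rows M))"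
      by (intro sum_list_mono) auto
    ultimately show ?thesis using \<open>length ws = m\<close> Mc by (simp add: sum_list_triv)
  qed
  then show ?thesis using minimal_basis_carrier_iff[OF Mc] q inj by blast
qed

subsection \<open>Sylvester matrices and minimality\<close>

text \<open>A strict degree bound under the convention that the zero polynomial has degree minus
  infinity: \<open>degree_less p 0\<close> means \<open>p = 0\<close>. Stated through coefficients,
  since \<open>degree 0 = 0\<close> would blur this case.\<close>

definition degree_less :: "'a::zero poly \<Rightarrow> nat \<Rightarrow> bool" where
  "degree_less p a \<longleftrightarrow> (\<forall>l\<ge>a. coeff p l = 0)"

lemma degree_less_iff: "degree_less p a \<longleftrightarrow> p = 0 \<or> degree p < a"
proof
  assume "degree_less p a"
  then show "p = 0 \<or> degree p < a"
    unfolding degree_less_def by (meson leading_coeff_0_iff not_le)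
qed (auto simp: degree_less_def coeff_eq_0)

lemma degree_less_mult:
  fixes p r :: "'a::idom poly"
  assumes "degree_less p a" and "degree r \<le> b"
  shows "degree_less (p * r) (a + b)"
  using assms degree_mult_le[of p r] by (auto simp: degree_less_iff)

lemma degree_less_mult_iff:
  fixes p u :: "'a::idom poly"
  assumes "p \<noteq> 0"
  shows "degree_less (p * u) (degree p + a) \<longleftrightarrow> degree_less u a"
  using assms by (cases "u = 0") (auto simp: degree_less_iff degree_mult_eq)

lemma row_comb_mult: "row_comb A (\<lambda>i. c * y i) j = c * row_comb A y j"
  by (simp add: row_comb_def sum_distrib_left mult.assoc)

lemma row_comb_add: "row_comb A (\<lambda>i. y i + z i) j = row_comb A y j + row_comb A z j"
  by (simp add: row_comb_def sum.distrib distrib_right)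

lemma degree_less_row_comb:
  fixes M :: "'a::idom poly mat"
  assumes M: "M \<in> poly_mats m q d" and Y: "\<And>i. i < m \<Longrightarrow> degree_less (Y i) a" and j: "j < q"
  shows "degree_less (row_comb M Y j) (a + d)"
proof -
  have "degree_less (Y i * M $$ (i, j)) (a + d)" if "i < m" for i
    using M j that Y by (intro degree_less_mult) (auto simp: poly_mats_def)
  then show ?thesis
    using M by (auto simp: degree_less_def row_comb_def coeff_sum poly_mats_def)
qed

text \<open>In the convolution only index \<open>D\<close> of \<open>Y i\<close> paired with index
  \<open>d\<close> of the entry of \<open>M\<close> survives: a smaller index in \<open>Y i\<close>
  needs a coefficient of \<open>M\<close> beyond \<open>d\<close>, a larger one is excluded by the
  bound on \<open>Y i\<close>.\<close>

lemma coeff_row_comb_top: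
  fixes M :: "'a::idom poly mat"
  assumes M: "M \<in> poly_mats m q d" and Y: "\<And>i. i < m \<Longrightarrow> degree_less (Y i) (Suc D)" and j: "j < q"
  shows "coeff (row_comb M Y j) (D + d) = row_comb (coeff_mat M d) (\<lambda>i. coeff (Y i) D) j"
proof -
  have "coeff (Y i * M $$ (i, j)) (D + d) = coeff (Y i) D * coeff (M $$ (i, j)) d" if i: "i < m" for i
  proof -
    have deg: "degree (M $$ (i, j)) \<le> d" using M i j by (auto simp: poly_mats_def)
    have "coeff (Y i * M $$ (i, j)) (D + d)
        = (\<Sum>s\<le>D + d. coeff (Y i) s * coeff (M $$ (i, j)) (D + d - s))"
      by (rule coeff_mult)
    also have "\<dots> = (\<Sum>s\<in>{D}. coeff (Y i) s * coeff (M $$ (i, j)) (D + d - s))"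
    proof (intro sum.mono_neutral_right ballI)
      fix s assume s: "s \<in> {..D + d} - {D}"
      show "coeff (Y i) s * coeff (M $$ (i, j)) (D + d - s) = 0"
      proof (cases "s < D")
        case True
        then show ?thesis using deg s by (simp add: coeff_eq_0)
      next
        case False
        then show ?thesis using s Y[OF i] by (auto simp: degree_less_def)
      qed
    qed auto
    finally show ?thesis by simp
  qed
  then show ?thesis
    using M j by (auto simp: row_comb_def coeff_sum coeff_mat_def poly_mats_def)
qed

text \<open>The predictable degree property of a row reduced matrix whose rows all have degree \<open>d\<close>.\<close>

lemma degree_less_of_row_comb:
  fixes M :: "'a::idom poly mat"
  assumes M: "M \<in> poly_mats m q d" and inj: "left_injective (coeff_mat M d)"
    and comb: "\<And>j. j < q \<Longrightarrow> degree_less (row_comb M Y j) (a + d)" and i: "i < m"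
  shows "degree_less (Y i) a"
proof -
  have dims: "dim_row (coeff_mat M d) = m" "dim_col (coeff_mat M d) = q"
    using M by (auto simp: coeff_mat_def poly_mats_def)
  \<comment> \<open>\<open>B\<close> is a common bound for all \<open>Y i\<close> that is at least
    \<open>a\<close>. The descent from \<open>B\<close> to \<open>a\<close> removes one coefficient
    at a time: those at \<open>D\<close> form a left null vector of \<open>coeff_mat M d\<close>,
    hence vanish.\<close>
  define B where "B = a + Suc (\<Sum>i<m. degree (Y i))"
  have B: "degree_less (Y i) B" if "i < m" for i
    using member_le_sum[of i "{..<m}" "\<lambda>i. degree (Y i)"] that
    by (auto simp: degree_less_iff B_def)
  have "a \<le> B" by (simp add: B_def)
  then have "\<forall>i<m. degree_less (Y i) a"
  proof (induction rule: inc_induct)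
    case base
    then show ?case using B by blast
  next
    case (step D)
    have "row_comb (coeff_mat M d) (\<lambda>i. coeff (Y i) D) j = 0" if j: "j < q" for j
      using coeff_row_comb_top[OF M _ j, of Y D] step comb[OF j] by (simp add: degree_less_def)
    then have "\<forall>i<m. coeff (Y i) D = 0"
      using inj dims by (auto simp: left_injective_def)
    moreover have "l = D \<or> Suc D \<le> l" if "D \<le> l" for l using that by auto
    ultimately show ?case using step.IH by (auto simp: degree_less_def)
  qed
  then show ?thesis using i by blast
qed

section \<open>Block indices and entries of Sylvester matrices\<close>

lemma mult_add_less: "a * m + i < N * m" if "a < N" "i < m" for a i m N :: nat
proof -
  have "a * m + i < Suc a * m" using that by simp
  also have "\<dots> \<le> N * m" using that by (intro mult_le_mono1) simp
  finally show ?thesis .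
qed

lemma sum_lessThan_mult:
  "(\<Sum>t<N * m. f t) = (\<Sum>a<N. \<Sum>i<m. f (a * m + i))" for f :: "nat \<Rightarrow> 'a::comm_monoid_add"
proof -
  have "(\<Sum>t<N * m. f t) = (\<Sum>a<N. sum f {a * m..<a * m + m})"
    by (rule sum.nat_group[symmetric])
  also have "\<dots> = (\<Sum>a<N. \<Sum>i<m. f (a * m + i))"
  proof (rule sum.cong[OF refl])
    fix a
    show "sum f {a * m..<a * m + m} = (\<Sum>i<m. f (a * m + i))"
      using sum.shift_bounds_nat_ivl[of f 0 "a * m" m] by (simp add: add.commute atLeast0LessThan)
  qed
  finally show ?thesis .
qed

lemma sylvester_carrier:
  assumes "M \<in> carrier_mat m q"
  shows "sylvester d k M \<in> carrier_mat ((k + d) * m) (k * q)"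
  using assms by (simp add: sylvester_def Let_def)

lemma sylvester_index:
  assumes "M \<in> carrier_mat m q" and "a < k + d" and "i < m" and "b < k" and "j < q"
  shows "sylvester d k M $$ (a * m + i, b * q + j)
    = (if b \<le> a \<and> a - b \<le> d then coeff (M $$ (i, j)) (a - b) else 0)"
proof -
  have "a * m + i < (k + d) * m" "b * q + j < k * q"
    using assms mult_add_less[of a "k + d" i m] mult_add_less[of b k j q] by auto
  then show ?thesis
    using assms by (simp add: sylvester_def Let_def coeff_mat_def)
qed

text \<open>The left factor \<open>y\<close> is read as the coefficient vector of a polynomial row \<open>Y\<close> in descending
  order, so that block \<open>b\<close> of \<open>y S\<^sub>k(M)\<close> consists of the coefficients of \<open>Y M\<close> at \<open>k + d - 1 - b\<close>.\<close>

lemma row_comb_sylvester: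
  fixes M :: "'a::comm_ring_1 poly mat"
  assumes M: "M \<in> poly_mats m q d"
    and Y: "\<And>a i. a < k + d \<Longrightarrow> i < m \<Longrightarrow> coeff (Y i) (k + d - 1 - a) = y (a * m + i)"
    and b: "b < k" and j: "j < q"
  shows "row_comb (sylvester d k M) y (b * q + j) = coeff (row_comb M Y j) (k + d - 1 - b)"
proof -
  define N where "N = k + d"
  have Mc: "M \<in> carrier_mat m q" and deg: "\<And>i. i < m \<Longrightarrow> degree (M $$ (i, j)) \<le> d"
    using M j by (auto simp: poly_mats_def)
  have entry: "coeff (Y i * M $$ (i, j)) (N - 1 - b)
      = (\<Sum>a<N. y (a * m + i) * (if b \<le> a \<and> a - b \<le> d then coeff (M $$ (i, j)) (a - b) else 0))"
    if i: "i < m" for i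
  proof -
    have "coeff (Y i * M $$ (i, j)) (N - 1 - b)
        = (\<Sum>s\<le>N - 1 - b. coeff (M $$ (i, j)) s * coeff (Y i) (N - 1 - b - s))"
      by (simp add: mult.commute[of "Y i"] coeff_mult)
    also have "\<dots> = (\<Sum>s\<le>N - 1 - b. y ((b + s) * m + i) * coeff (M $$ (i, j)) s)"
      using Y[of "b + _" i] b i by (intro sum.cong) (auto simp: N_def mult.commute)
    also have "\<dots> = (\<Sum>a\<in>{b..<N}. y (a * m + i) * coeff (M $$ (i, j)) (a - b))"
      using b by (intro sum.reindex_bij_witness[of _ "\<lambda>a. a - b" "\<lambda>s. b + s"]) (auto simp: N_def)
    \<comment> \<open>Cutting off at \<open>a - b <= d\<close> changes nothing, since the entries of
      \<open>M\<close> have degree at most \<open>d\<close>.\<close>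
    also have "\<dots> = (\<Sum>a\<in>{b..<N}. y (a * m + i) *
        (if b \<le> a \<and> a - b \<le> d then coeff (M $$ (i, j)) (a - b) else 0))"
      using deg[OF i] by (intro sum.cong) (auto simp: coeff_eq_0)
    also have "\<dots> = (\<Sum>a<N. y (a * m + i) *
        (if b \<le> a \<and> a - b \<le> d then coeff (M $$ (i, j)) (a - b) else 0))"
      by (intro sum.mono_neutral_left) auto
    finally show ?thesis .
  qed
  have "row_comb (sylvester d k M) y (b * q + j)
      = (\<Sum>a<N. \<Sum>i<m. y (a * m + i) * sylvester d k M $$ (a * m + i, b * q + j))"
    using sylvester_carrier[OF Mc, of d k] by (simp add: row_comb_def sum_lessThan_mult N_def)
  also have "\<dots> = (\<Sum>a<N. \<Sum>i<m. y (a * m + i) *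
      (if b \<le> a \<and> a - b \<le> d then coeff (M $$ (i, j)) (a - b) else 0))"
    using Mc b j by (intro sum.cong refl) (simp add: sylvester_index N_def)
  also have "\<dots> = (\<Sum>i<m. coeff (Y i * M $$ (i, j)) (N - 1 - b))"
    by (subst sum.swap) (intro sum.cong refl, simp only: entry lessThan_iff)
  also have "\<dots> = coeff (row_comb M Y j) (N - 1 - b)"
    using Mc by (simp add: row_comb_def coeff_sum)
  finally show ?thesis by (simp add: N_def)
qed

text \<open>Rows \<open>y\<close> of length \<open>(k + d) m\<close> correspond to polynomial rows
  \<open>Y\<close> of degree below \<open>k + d\<close>, and \<open>y S_k(M) = 0\<close> says that
  the \<open>k\<close> coefficients of \<open>Y M\<close> from \<open>d\<close> to
  \<open>k + d - 1\<close> vanish. The coefficients outside this window are left free.\<close>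

lemma left_injective_sylvester_iff:
  fixes M :: "'a::comm_ring_1 poly mat"
  assumes M: "M \<in> poly_mats m q d"
  shows "left_injective (sylvester d k M) \<longleftrightarrow>
    (\<forall>Y. (\<forall>i<m. degree_less (Y i) (k + d)) \<longrightarrow>
         (\<forall>j<q. \<forall>l. d \<le> l \<longrightarrow> l < k + d \<longrightarrow> coeff (row_comb M Y j) l = 0) \<longrightarrow>
         (\<forall>i<m. Y i = 0))" (is "?L \<longleftrightarrow> ?R")
proof -
  define N where "N = k + d"
  have Mc: "M \<in> carrier_mat m q" using M by (simp add: poly_mats_def)
  have dims: "dim_row (sylvester d k M) = N * m" "dim_col (sylvester d k M) = k * q"
    using sylvester_carrier[OF Mc, of d k] by (auto simp: N_def)
  show ?thesis
  proof
    assume L: ?L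
    show ?R
    proof (intro allI impI)
      fix Y i
      assume Y: "\<forall>i<m. degree_less (Y i) (k + d)" and i: "i < m"
        and window: "\<forall>j<q. \<forall>l. d \<le> l \<longrightarrow> l < k + d \<longrightarrow> coeff (row_comb M Y j) l = 0"
      define y where "y t = coeff (Y (t mod m)) (N - 1 - t div m)" for t
      have y: "coeff (Y i) (k + d - 1 - a) = y (a * m + i)" if "i < m" for a i
        using that by (simp add: y_def N_def)
      have "row_comb (sylvester d k M) y t = 0" if t: "t < k * q" for t
      proof -
        have "q > 0" using t by (cases q) auto
        then have "t mod q < q" "t div q < k" using t by (auto simp: less_mult_imp_div_less)
        then have "row_comb (sylvester d k M) y (t div q * q + t mod q)
            = coeff (row_comb M Y (t mod q)) (k + d - 1 - t div q)"
          using y by (intro row_comb_sylvester[OF M]) auto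
        also have "\<dots> = 0" using window \<open>t mod q < q\<close> \<open>t div q < k\<close> by auto
        finally show ?thesis by simp
      qed
      then have y0: "y t = 0" if "t < N * m" for t
        using L dims that by (auto simp: left_injective_def)
      have "coeff (Y i) l = 0" for l
      proof (cases "l < N")
        case True
        then have "coeff (Y i) l = y ((N - 1 - l) * m + i)"
          using y[OF i, of "N - 1 - l"] by (simp add: N_def)
        also have "\<dots> = 0"
          using True i by (intro y0 mult_add_less) auto
        finally show ?thesis .
      next
        case False
        then show ?thesis using Y i by (auto simp: degree_less_def N_def)
      qed
      then show "Y i = 0" by (simp add: poly_eq_iff)
    qed
  next
    assume R: ?R
    show ?L unfolding left_injective_def dims
    proof (intro allI impI)
      fix y t assume y: "\<forall>j<k * q. row_comb (sylvester d k M) y j = 0" and t: "t < N * m"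
      define Y where "Y i = (\<Sum>l<N. monom (y ((N - 1 - l) * m + i)) l)" for i
      have coeff_Y: "coeff (Y i) l = (if l < N then y ((N - 1 - l) * m + i) else 0)" for i l
        by (auto simp: Y_def coeff_sum)
      have "coeff (row_comb M Y j) l = 0" if "j < q" "d \<le> l" "l < k + d" for j l
      proof -
        define b where "b = N - 1 - l"
        have b: "b < k" "l = k + d - 1 - b" using that by (auto simp: b_def N_def)
        have "row_comb (sylvester d k M) y (b * q + j) = coeff (row_comb M Y j) l"
          unfolding b(2) using b that
          by (intro row_comb_sylvester[OF M]) (auto simp: coeff_Y N_def)
        moreover have "b * q + j < k * q" using b(1) that(1) by (rule mult_add_less)
        ultimately show ?thesis using y by simp
      qed
      moreover have "degree_less (Y i) (k + d)" for i
        by (simp add: degree_less_def coeff_Y N_def)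
      ultimately have Y0: "\<forall>i<m. Y i = 0" using R by blast
      have "m > 0" using t by (cases m) auto
      then have "t mod m < m" "t div m < N" using t by (auto simp: less_mult_imp_div_less)
      then have "coeff (Y (t mod m)) (N - 1 - t div m) = y t"
        by (simp add: coeff_Y)
      then show "y t = 0" using Y0 \<open>t mod m < m\<close> by simp
    qed
  qed
qed

section \<open>Full row rank of Sylvester matrices and minimality\<close>

lemma coeff_mat_carrier: "M \<in> poly_mats m q d \<Longrightarrow> coeff_mat M i \<in> carrier_mat m q"
  by (auto simp: coeff_mat_def poly_mats_def)

lemma full_row_degree:
  fixes M :: "'a::field poly mat"
  assumes M: "M \<in> poly_mats m q d" and inj: "left_injective (coeff_mat M d)" and i: "i < m"
  shows "d \<le> vec_degree (row M i)"
proof -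
  have dims: "dim_row (coeff_mat M d) = m" "dim_col (coeff_mat M d) = q" "dim_row M = m" "dim_col M = q"
    using coeff_mat_carrier[OF M, of d] M by (auto simp: poly_mats_def)
  have "\<exists>j<q. coeff (M $$ (i, j)) d \<noteq> 0"
  proof (rule ccontr)
    assume "\<not> (\<exists>j<q. coeff (M $$ (i, j)) d \<noteq> 0)"
    then have "row_comb (coeff_mat M d) (\<lambda>l. if l = i then 1 else 0) j = 0" if "j < q" for j
      using that dims i by (auto simp: row_comb_def coeff_mat_def if_distrib[of "\<lambda>x. x * _"] cong: if_cong)
    then have "(if i = i then 1 else 0) = (0::'a)"
      using inj[unfolded left_injective_def, THEN spec, of "\<lambda>l. if l = i then 1 else 0"] dims i by blast
    then show False by simp
  qed
  then obtain j where j: "j < q" "coeff (M $$ (i, j)) d \<noteq> 0" by blast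
  then have "d \<le> degree (row M i $ j)" using dims i by (simp add: le_degree)
  also have "\<dots> \<le> vec_degree (row M i)" using j dims by (intro degree_le_vec_degree) simp
  finally show ?thesis .
qed

text \<open>There are \<open>d m\<close> linear conditions, one for each row and each index of the
  window, on the \<open>d m + 1\<close> coefficients of \<open>r\<close>.\<close>

lemma exists_multiplier_window_zero:
  fixes Y :: "nat \<Rightarrow> 'a::field poly"
  shows "\<exists>r. r \<noteq> 0 \<and> degree r \<le> d * m \<and> (\<forall>i<m. \<forall>l. k \<le> l \<longrightarrow> l < k + d \<longrightarrow> coeff (r * Y i) l = 0)"
proof -
  define f where "f t s = coeff (monom 1 s * Y (t mod m)) (k + t div m)" for t s
  obtain x where x: "\<exists>s\<le>d * m. x s \<noteq> 0" "\<forall>t<d * m. (\<Sum>s\<le>d * m. f t s * x s) = 0"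
    using homogeneous_system_nontrivial[of "d * m" f] by blast
  define r where "r = (\<Sum>s\<le>d * m. monom (x s) s)"
  have coeff_r: "coeff r s = (if s \<le> d * m then x s else 0)" for s
    by (auto simp: r_def coeff_sum)
  have "r \<noteq> 0" using x(1) coeff_r by (metis coeff_0)
  moreover have "degree r \<le> d * m" using coeff_r by (intro degree_le) auto
  moreover have "coeff (r * Y i) l = 0" if "i < m" "k \<le> l" "l < k + d" for i l
  proof -
    define t where "t = (l - k) * m + i"
    have t: "t < d * m" "t mod m = i" "k + t div m = l"
      using that mult_add_less[of "l - k" d i m] by (auto simp: t_def)
    have "r * Y i = (\<Sum>s\<le>d * m. smult (x s) (monom 1 s * Y i))"
      by (simp add: r_def sum_distrib_right smult_monom flip: mult_smult_left)
    then have "coeff (r * Y i) l = (\<Sum>s\<le>d * m. f t s * x s)"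
      by (simp add: coeff_sum f_def t(2,3) mult.commute)
    then show ?thesis using x(2) t(1) by simp
  qed
  ultimately show ?thesis by blast
qed

lemma poly_shift_cutoff: "p = monom 1 n * poly_shift n p + poly_cutoff n p"
  for p :: "'a::comm_ring_1 poly"
  by (auto simp: poly_eq_iff coeff_poly_shift coeff_poly_cutoff coeff_monom_mult)

text \<open>The Laurent expansion is kept polynomial by scaling with \<open>monom 1 N\<close>.
  Minimality removes the part of \<open>r Y\<close> at and above \<open>N\<close>, which puts
  \<open>Y\<close> below degree \<open>k\<close>; the vanishing window then brings
  \<open>Y M\<close> below degree \<open>d\<close>, and the predictable degree property gives
  \<open>Y = 0\<close>.\<close>

lemma left_injective_sylvester:
  fixes M :: "'a::field poly mat"
  assumes M: "M \<in> poly_mats m q d" and min: "minimal_basis M"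
    and inj: "left_injective (coeff_mat M d)" and k: "d * m \<le> k"
  shows "left_injective (sylvester d k M)"
  unfolding left_injective_sylvester_iff[OF M]
proof (intro allI impI)
  fix Y i
  assume Y: "\<forall>i<m. degree_less (Y i) (k + d)" and i: "i < m"
    and window: "\<forall>j<q. \<forall>l. d \<le> l \<longrightarrow> l < k + d \<longrightarrow> coeff (row_comb M Y j) l = 0"
  define N where "N = k + d"
  have Mc: "M \<in> carrier_mat m q" using M by (simp add: poly_mats_def)
  obtain r where r: "r \<noteq> 0" "degree r \<le> d * m"
    and r_window: "\<And>i l. i < m \<Longrightarrow> k \<le> l \<Longrightarrow> l < N \<Longrightarrow> coeff (r * Y i) l = 0"
    using exists_multiplier_window_zero[of d m k Y] unfolding N_def by blast
  \<comment> \<open>\<open>v\<close> and \<open>w\<close> are the quotients, \<open>e\<close> and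
    \<open>g\<close> the remainders, on division of \<open>r Y\<close> and \<open>Y M\<close> by
    \<open>monom 1 N\<close>. The choice of \<open>r\<close> puts \<open>e\<close> below degree
    \<open>k\<close>, and the window in the hypothesis puts \<open>g\<close> below degree
    \<open>d\<close>.\<close>
  define v where "v i = poly_shift N (r * Y i)" for i
  define w where "w j = poly_shift N (row_comb M Y j)" for j
  define e where "e i = poly_cutoff N (r * Y i)" for i
  define g where "g j = poly_cutoff N (row_comb M Y j)" for j
  have Y_eq: "r * Y i = monom 1 N * v i + e i" for i
    unfolding v_def e_def by (rule poly_shift_cutoff)
  have comb_eq: "row_comb M Y j = monom 1 N * w j + g j" for j
    unfolding w_def g_def by (rule poly_shift_cutoff)
  have e: "degree_less (e i) k" if "i < m" for i
    using r_window[OF that] by (auto simp: degree_less_def e_def coeff_poly_cutoff not_less)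
  have g: "degree_less (g j) d" if "j < q" for j
    using window that by (auto simp: degree_less_def g_def coeff_poly_cutoff N_def)
  have w: "degree_less (w j) d" if "j < q" for j
    using degree_less_row_comb[OF M _ that, of Y N] Y
    by (auto simp: degree_less_def w_def coeff_poly_shift N_def add.commute)
  have rw: "r * w j = row_comb M v j" if j: "j < q" for j
  proof -
    have "monom 1 N * row_comb M v j + row_comb M e j = row_comb M (\<lambda>i. r * Y i) j"
      unfolding Y_eq row_comb_add row_comb_mult ..
    also have "\<dots> = monom 1 N * (r * w j) + r * g j"
      unfolding row_comb_mult comb_eq by (simp add: algebra_simps)
    finally have eq: "monom 1 N * (r * w j - row_comb M v j) = row_comb M e j - r * g j"
      by (simp add: algebra_simps)
    \<comment> \<open>Both terms on the right of \<open>eq\<close> have degree below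
      \<open>N\<close>; for \<open>r g\<close> this is where \<open>d m <= k\<close> enters. A
      multiple of \<open>monom 1 N\<close> of degree below \<open>N\<close> is zero, which gives
      \<open>r w = v M\<close>.\<close>
    have "degree_less (row_comb M e j) N"
      unfolding N_def using degree_less_row_comb[OF M e j] by simp
    moreover have "degree_less (g j * r) (d + d * m)"
      using g[OF j] r(2) by (rule degree_less_mult)
    ultimately have "degree_less (row_comb M e j - r * g j) N"
      using k by (auto simp: degree_less_def N_def mult.commute)
    then have "coeff (r * w j - row_comb M v j) l = 0" for l
      unfolding eq[symmetric] degree_less_def by (auto simp: coeff_monom_mult dest: spec[of _ "N + l"])
    then show ?thesis by (simp add: poly_eq_iff)
  qed
  have v0: "v l = 0" if l: "l < m" for l
  proof (rule ccontr)
    \<comment> \<open>Then \<open>w\<close> could replace row \<open>l\<close>, which has degree at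
      least \<open>d\<close>, although \<open>w\<close> has degree below \<open>d\<close>.\<close>
    assume "v l \<noteq> 0"
    then obtain j where "j < q" "w j \<noteq> 0" "vec_degree (row M l) \<le> degree (w j)"
      using minimal_basis_row_degree_le[OF Mc min l r(1)] rw by blast
    moreover have "d \<le> vec_degree (row M l)" by (rule full_row_degree[OF M inj l])
    ultimately show False using w[of j] by (simp add: degree_less_iff)
  qed
  have Y_low: "degree_less (Y l) k" if "l < m" for l
  proof (cases "Y l = 0")
    case False
    have "r * Y l = e l" using Y_eq[of l] v0[OF that] by simp
    then have "degree_less (r * Y l) k" using e[OF that] by simp
    then show ?thesis using False r(1) by (auto simp: degree_less_iff degree_mult_eq)
  qed (simp add: degree_less_iff)
  \<comment> \<open>The bound on \<open>Y\<close> handles the coefficients from \<open>k + d\<close>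
    on, the window those from \<open>d\<close> to \<open>k + d - 1\<close>. The sum
    \<open>0 + d\<close> has the shape expected by the predictable degree property with
    \<open>a = 0\<close>.\<close>
  have "degree_less (row_comb M Y j) (0 + d)" if "j < q" for j
    unfolding degree_less_def
  proof (intro allI impI)
    fix l assume "0 + d \<le> l"
    then show "coeff (row_comb M Y j) l = 0"
      using degree_less_row_comb[OF M Y_low that] window that
      by (cases "l < k + d") (simp_all add: degree_less_def)
  qed
  then have "degree_less (Y i) 0"
    using degree_less_of_row_comb[OF M inj _ i, of Y 0] by blast
  then show "Y i = 0" by (simp add: degree_less_iff)
qed

text \<open>The last block row of \<open>S_k(M)\<close> has \<open>M_d\<close> in its last block and
  zeros elsewhere. In polynomial terms, a left null vector of \<open>M_d\<close> is a constant row
  \<open>Y\<close> for which \<open>Y M\<close> has degree below \<open>d\<close>.\<close>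

lemma left_injective_top_coeff_of_sylvester:
  fixes M :: "'a::field poly mat"
  assumes M: "M \<in> poly_mats m q d" and inj: "left_injective (sylvester d k M)" and k: "k > 0"
  shows "left_injective (coeff_mat M d)"
  unfolding left_injective_def
proof (intro allI impI)
  have dims: "dim_row (coeff_mat M d) = m" "dim_col (coeff_mat M d) = q"
    using coeff_mat_carrier[OF M, of d] by auto
  fix y i assume y: "\<forall>j<dim_col (coeff_mat M d). row_comb (coeff_mat M d) y j = 0"
    and i: "i < dim_row (coeff_mat M d)"
  define Y where "Y i = [:y i:]" for i
  have Y: "degree_less (Y l) (Suc 0)" for l by (simp add: degree_less_iff Y_def)
  have "coeff (row_comb M Y j) l = 0" if "j < q" "d \<le> l" for j l
  proof (cases "l = d")
    case True
    then show ?thesis using coeff_row_comb_top[OF M _ that(1), of Y 0] Y y dims that(1) by (simp add: Y_def)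
  next
    case False
    then show ?thesis using degree_less_row_comb[OF M _ that(1), of Y "Suc 0"] Y that
      by (auto simp: degree_less_def)
  qed
  moreover have "degree_less (Y l) (k + d)" for l using k by (simp add: degree_less_iff Y_def)
  ultimately have "Y i = 0"
    using inj[unfolded left_injective_sylvester_iff[OF M], THEN spec, of Y] i dims by blast
  then show "y i = 0" by (simp add: Y_def)
qed

text \<open>It suffices to exclude a relation \<open>p w = v M\<close> with nonzero \<open>w\<close>
  of degree below \<open>d\<close>. Let \<open>Y\<close> be the polynomial part of
  \<open>monom 1 N * v / p\<close>. Then \<open>Y M\<close> equals \<open>monom 1 N * w\<close> up
  to terms of degree below \<open>d\<close>, so its window is zero and \<open>Y = 0\<close>; this
  leaves too small a degree for \<open>p w\<close>.\<close>

lemma minimal_basis_of_sylvester: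
  fixes M :: "'a::field poly mat"
  assumes M: "M \<in> poly_mats m q d" and mq: "m < q"
    and inj: "left_injective (sylvester d k M)" and k: "k > 0"
  shows "minimal_basis M"
proof (rule minimal_basisI[OF M mq])
  note top = left_injective_top_coeff_of_sylvester[OF M inj k]
  have Mc: "M \<in> carrier_mat m q" using M by (simp add: poly_mats_def)
  show "left_injective M" unfolding left_injective_def
  proof (intro allI impI)
    fix v i assume "\<forall>j<dim_col M. row_comb M v j = 0" and i: "i < dim_row M"
    then have "degree_less (row_comb M v j) (0 + d)" if "j < q" for j
      using that Mc by (simp add: degree_less_def)
    then have "degree_less (v i) 0"
      using degree_less_of_row_comb[OF M top _ _, of v 0] i Mc by blast
    then show "v i = 0" by (simp add: degree_less_iff)
  qed
  fix p v w j0
  assume p: "p \<noteq> 0" and pw: "\<And>j. j < q \<Longrightarrow> p * w j = row_comb M v j"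
    and w: "\<And>j. j < q \<Longrightarrow> degree (w j) < d" and j0: "j0 < q"
  define N where "N = k + d"
  define Y where "Y i = (monom 1 N * v i) div p" for i
  define e where "e i = (monom 1 N * v i) mod p" for i
  have Y_eq: "p * Y i + e i = monom 1 N * v i" for i
    by (simp add: Y_def e_def)
  \<comment> \<open>\<open>v M = p w\<close> has degree below \<open>degree p + d\<close>, so the
    predictable degree property makes \<open>v / p\<close> a proper fraction. This is what keeps
    \<open>Y\<close> below degree \<open>N\<close>.\<close>
  have v: "degree_less (v i) (degree p)" if i: "i < m" for i
  proof (rule degree_less_of_row_comb[OF M top _ i])
    fix j assume j: "j < q"
    have "degree_less (p * w j) (degree p + d)"
      unfolding degree_less_mult_iff[OF p] using w[OF j] by (simp add: degree_less_iff)
    then show "degree_less (row_comb M v j) (degree p + d)" using pw[OF j] by simp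
  qed
  have e: "degree_less (e i) (degree p)" for i
    using degree_mod_less[OF p, of "monom 1 N * v i"] by (auto simp: e_def degree_less_iff)
  have Y_deg: "degree_less (Y i) N" if "i < m" for i
  proof -
    have "degree_less (v i * monom 1 N) (degree p + N)"
      using v[OF that] by (rule degree_less_mult) (simp add: degree_monom_eq)
    then have "degree_less (p * Y i) (degree p + N)"
      using e[of i] Y_eq[of i] by (auto simp: degree_less_def mult.commute)
        (metis add_0_right coeff_add add_leD1)
    then show ?thesis unfolding degree_less_mult_iff[OF p] .
  qed
  \<comment> \<open>The difference equals \<open>- e M / p\<close>, where \<open>e\<close> has
    degree below \<open>degree p\<close>.\<close>
  have comb: "degree_less (row_comb M Y j - monom 1 N * w j) d" if j: "j < q" for j
  proof -
    have "p * row_comb M Y j + row_comb M e j = row_comb M (\<lambda>i. monom 1 N * v i) j"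
      unfolding Y_eq[symmetric] row_comb_add row_comb_mult ..
    also have "\<dots> = p * (monom 1 N * w j)"
      unfolding row_comb_mult pw[OF j, symmetric] by (simp add: mult_ac)
    finally have "p * (row_comb M Y j - monom 1 N * w j) = - row_comb M e j"
      by (simp add: algebra_simps eq_neg_iff_add_eq_0)
    moreover have "degree_less (- row_comb M e j) (degree p + d)"
      using degree_less_row_comb[OF M e j] by (simp add: degree_less_def)
    ultimately show ?thesis by (metis degree_less_mult_iff[OF p])
  qed
  have "coeff (row_comb M Y j) l = 0" if "j < q" "d \<le> l" "l < N" for j l
    using comb[OF that(1)] that by (auto simp: degree_less_def coeff_monom_mult)
  then have Y0: "\<forall>i<m. Y i = 0"
    using inj[unfolded left_injective_sylvester_iff[OF M], THEN spec, of Y] Y_deg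
    unfolding N_def by blast
  \<comment> \<open>With \<open>Y = 0\<close> the row \<open>monom 1 N * v\<close> is its own
    remainder \<open>e\<close>. A nonzero \<open>w\<close> would make \<open>monom 1 N * w\<close>
    of degree at least \<open>N\<close>, which exceeds \<open>d\<close>.\<close>
  have "degree_less (row_comb M (\<lambda>i. monom 1 N * v i) j0) (degree p + d)"
    using Y0 Y_eq e by (intro degree_less_row_comb[OF M _ j0]) (metis add_0 mult_zero_right)
  also have "row_comb M (\<lambda>i. monom 1 N * v i) j0 = p * (monom 1 N * w j0)"
    unfolding row_comb_mult pw[OF j0, symmetric] by (simp add: mult_ac)
  finally have "degree_less (monom 1 N * w j0) d" unfolding degree_less_mult_iff[OF p] .
  then show "w j0 = 0"
    using k by (cases "w j0 = 0")
      (auto simp: degree_less_iff degree_mult_eq degree_monom_eq monom_eq_0_iff N_def)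
qed

subsection \<open>Hermitian matrices and singular values\<close>

lemma mat_adjoint_dim [simp]:
  "dim_row (mat_adjoint A) = dim_col A" "dim_col (mat_adjoint A) = dim_row A"
  unfolding mat_adjoint_def by simp_all

lemma mat_adjoint_carrier: "A \<in> carrier_mat p q \<Longrightarrow> mat_adjoint A \<in> carrier_mat q p"
  by (auto intro: carrier_matI)

lemma mat_adjoint_index [simp]:
  assumes "i < dim_col A" and "j < dim_row A"
  shows "mat_adjoint A $$ (i, j) = conjugate (A $$ (j, i))"
  unfolding mat_adjoint_def using assms by (subst mat_of_rows_index) auto

lemma mat_adjoint_adjoint: "mat_adjoint (mat_adjoint A) = A"
  by (rule eq_matI) auto

lemma mat_adjoint_mult:
  fixes A B :: "'a::conjugatable_field mat"
  assumes "A \<in> carrier_mat p q" and "B \<in> carrier_mat q r"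
  shows "mat_adjoint (A * B) = mat_adjoint B * mat_adjoint A"
proof (rule eq_matI)
  fix i j assume "i < dim_row (mat_adjoint B * mat_adjoint A)" "j < dim_col (mat_adjoint B * mat_adjoint A)"
  then have ij: "i < r" "j < p" using assms by auto
  have "mat_adjoint (A * B) $$ (i, j) = conjugate (\<Sum>k<q. A $$ (j, k) * B $$ (k, i))"
    using assms ij by (simp add: scalar_prod_def atLeast0LessThan)
  also have "\<dots> = (\<Sum>k<q. conjugate (B $$ (k, i)) * conjugate (A $$ (j, k)))"
    by (simp add: sum_conjugate conjugate_dist_mul mult.commute)
  also have "\<dots> = (mat_adjoint B * mat_adjoint A) $$ (i, j)"
    using assms ij by (simp add: scalar_prod_def atLeast0LessThan)
  finally show "mat_adjoint (A * B) $$ (i, j) = (mat_adjoint B * mat_adjoint A) $$ (i, j)" .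
qed (use assms in auto)

lemma conjugate_one: "conjugate (1::'a::conjugatable_field) = 1"
proof -
  have "conjugate (1::'a) * conjugate 1 = conjugate 1 * 1"
    using conjugate_dist_mul[of "1::'a" 1] by simp
  then show ?thesis by (metis conjugate_zero_iff mult_cancel_left zero_neq_one)
qed

lemma proots_prod_linear: "proots (\<Prod>e\<leftarrow>es. [:- e, 1:]) = mset es" for es :: "'a::idom list"
proof (induction es)
  case (Cons e es)
  have "(\<Prod>e\<leftarrow>es. [:- e, 1:]) \<noteq> 0" by (auto simp: prod_list_zero_iff)
  then show ?case using Cons by (simp add: proots_mult del: mult_pCons_left)
qed simp

lemma degree_prod_linear: "degree (\<Prod>e\<leftarrow>es. [:- e, 1:]) = length es" for es :: "'a::idom list"
proof (induction es)
  case (Cons e es)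
  have "(\<Prod>e\<leftarrow>es. [:- e, 1:]) \<noteq> 0" by (auto simp: prod_list_zero_iff)
  then show ?case using Cons by (simp add: degree_mult_eq del: mult_pCons_left)
qed simp

text \<open>The common properties of \<open>\<real>\<close> and \<open>\<complex>\<close> from which the spectral theorem follows, once the
  characteristic polynomial of a Hermitian matrix is known to split.\<close>

class rc_field = conjugatable_ordered_field + real_normed_field +
  assumes mult_conjugate_scaleR: "x * conjugate x = ((norm x)\<^sup>2) *\<^sub>R 1"

lemma mult_conjugate: "x * conjugate x = of_real ((norm x)\<^sup>2)" for x :: "'a::rc_field"
  unfolding of_real_def by (rule mult_conjugate_scaleR)

instance real :: rc_field by intro_classes (simp add: power2_eq_square)

instance complex :: rc_field
proof
  fix x :: complex
  show "x * conjugate x = ((norm x)\<^sup>2) *\<^sub>R 1"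
    using complex_norm_square[of x] by (simp add: scaleR_conv_of_real)
qed

text \<open>A nonnegative real is \<open>x * conjugate x\<close> for \<open>x\<close> its square
  root, and such a product is fixed by conjugation. Negative reals follow by a sign.\<close>

lemma conjugate_of_real [simp]: "conjugate (of_real r :: 'a::rc_field) = of_real r"
proof -
  have nonneg: "conjugate (of_real r :: 'a) = of_real r" if "r \<ge> 0" for r
  proof -
    have "of_real r = (of_real (sqrt r) :: 'a) * conjugate (of_real (sqrt r))"
      using that mult_conjugate[of "of_real (sqrt r) :: 'a"] by simp
    then show ?thesis
      by (metis conjugate_dist_mul conjugate_id mult.commute)
  qed
  show ?thesis
  proof (cases "r \<ge> 0")
    case False
    then have "conjugate (- of_real (- r) :: 'a) = - of_real (- r)"
      using nonneg[of "- r"] by (simp only: conjugate_neg)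
    then show ?thesis by simp
  qed (rule nonneg)
qed

lemma conjugate_divide_of_real: "conjugate (x / of_real r :: 'a::rc_field) = conjugate x / of_real r"
  unfolding divide_inverse of_real_inverse[symmetric] conjugate_dist_mul conjugate_of_real ..

text \<open>\<open>gram_schmidt\<close> yields an orthogonal basis that begins with
  \<open>v\<close>; dividing each vector by its length makes it orthonormal.\<close>

lemma exists_unitary_first_col:
  fixes v :: "'a::rc_field vec"
  assumes v: "v \<in> carrier_vec n" "v \<noteq> 0\<^sub>v n"
  shows "\<exists>W c. W \<in> carrier_mat n n \<and> mat_adjoint W * W = 1\<^sub>m n \<and> col W 0 = c \<cdot>\<^sub>v v"
proof -
  interpret cof_vec_space n "TYPE('a)" .
  have "n \<noteq> 0" using v by (cases "n = 0") auto
  define b where "b = basis_completion v"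
  define ws where "ws = gram_schmidt n b"
  from basis_completion[OF v(1) v(2), folded b_def]
  have b: "distinct b" "\<not> lin_dep (set b)" "set b \<subseteq> carrier_vec n" "hd b = v" "length b = n" by auto
  then obtain bs where bs: "b = v # bs" using \<open>n \<noteq> 0\<close> by (cases b) auto
  from gram_schmidt_result[OF b(3,1,2) refl, folded ws_def]
  have ws: "set ws \<subseteq> carrier_vec n" "corthogonal ws" "length ws = n"
    by (auto simp: b)
  have "hd ws = v" unfolding ws_def bs using v(1) by (rule gram_schmidt_hd)
  then have ws0: "ws ! 0 = v" using ws(3) \<open>n \<noteq> 0\<close> by (cases ws) auto
  define s where "s j = sqrt (\<Sum>i<n. (norm (ws ! j $ i))\<^sup>2)" for j
  define W where "W = mat n n (\<lambda>(i, j). ws ! j $ i / of_real (s j))"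
  have W: "W \<in> carrier_mat n n" by (simp add: W_def)
  have dims: "dim_vec (ws ! j) = n" if "j < n" for j
    using ws that by (metis carrier_vecD nth_mem subsetD)
  have inner: "ws ! i \<bullet>c ws ! i = of_real ((s i)\<^sup>2)" if "i < n" for i
    using dims[OF that]
    by (simp add: s_def scalar_prod_def mult_conjugate sum_nonneg atLeast0LessThan)
  have s_nz: "s i \<noteq> 0" if "i < n" for i
    using inner[OF that] corthogonalD[OF ws(2), of i i] that ws(3) by auto
  have "mat_adjoint W * W = 1\<^sub>m n"
  proof (rule eq_matI)
    fix i j assume ij: "i < dim_row (1\<^sub>m n :: 'a mat)" "j < dim_col (1\<^sub>m n :: 'a mat)"
    then have ij: "i < n" "j < n" by auto
    have "(mat_adjoint W * W) $$ (i, j)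
        = (\<Sum>k<n. conjugate (ws ! i $ k / of_real (s i)) * (ws ! j $ k / of_real (s j)))"
      using ij W by (simp add: scalar_prod_def W_def atLeast0LessThan)
    also have "\<dots> = (\<Sum>k<n. ws ! j $ k * conjugate (ws ! i $ k)) / (of_real (s i) * of_real (s j))"
      unfolding sum_divide_distrib
      by (intro sum.cong) (auto simp: conjugate_divide_of_real mult.commute)
    also have "(\<Sum>k<n. ws ! j $ k * conjugate (ws ! i $ k)) = ws ! j \<bullet>c ws ! i"
      using ij dims by (simp add: scalar_prod_def atLeast0LessThan)
    also have "\<dots> / (of_real (s i) * of_real (s j)) = 1\<^sub>m n $$ (i, j)"
    proof (cases "i = j")
      case True
      then show ?thesis using inner[OF ij(1)] s_nz[OF ij(1)] ij by (simp add: power2_eq_square)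
    next
      case False
      then show ?thesis using corthogonalD[OF ws(2), of j i] ij ws(3) by simp
    qed
    finally show "(mat_adjoint W * W) $$ (i, j) = 1\<^sub>m n $$ (i, j)" .
  qed (use W in auto)
  moreover have "col W 0 = inverse (of_real (s 0)) \<cdot>\<^sub>v v"
    using \<open>n \<noteq> 0\<close> ws0 v(1) by (intro eq_vecI) (auto simp: W_def divide_inverse mult.commute)
  ultimately show ?thesis using W by blast
qed

text \<open>Deflation by induction on the list of eigenvalues. In an orthonormal basis beginning
  with an eigenvector for \<open>e\<close> the matrix splits into \<open>e\<close> and a Hermitian
  block with the remaining characteristic polynomial. The diagonal keeps the order of
  \<open>es\<close>.\<close>

lemma hermitian_unitary_diag:
  fixes A :: "'a::rc_field mat"
  assumes "A \<in> carrier_mat n n" and "mat_adjoint A = A"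
    and "char_poly A = (\<Prod>e\<leftarrow>es. [:- e, 1:])"
  shows "\<exists>U. U \<in> carrier_mat n n \<and> mat_adjoint U * U = 1\<^sub>m n \<and>
    mat_adjoint U * A * U = mat n n (\<lambda>(i, j). if i = j then es ! i else 0)"
  using assms
proof (induction es arbitrary: n A)
  case Nil
  then have "n = 0" using degree_monic_char_poly[of A n] by simp
  then show ?case by (intro exI[of _ "1\<^sub>m n"]) (auto intro!: eq_matI)
next
  case (Cons e es)
  note A = \<open>A \<in> carrier_mat n n\<close> and herm = \<open>mat_adjoint A = A\<close>
  have cp: "char_poly A = [:- e, 1:] * (\<Prod>e\<leftarrow>es. [:- e, 1:])" using Cons.prems by simp
  have "n = Suc (length es)"
    using degree_monic_char_poly[OF A] Cons.prems(3) degree_prod_linear[of "e # es"] by simp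
  then obtain k where n: "n = Suc k" by simp
  have "eigenvalue A e"
    unfolding eigenvalue_root_char_poly[OF A] cp by simp
  then obtain v where v: "v \<in> carrier_vec n" "v \<noteq> 0\<^sub>v n" "A *\<^sub>v v = e \<cdot>\<^sub>v v"
    unfolding eigenvalue_def eigenvector_def using A by auto
  obtain W c where W: "W \<in> carrier_mat n n" "mat_adjoint W * W = 1\<^sub>m n" and W0: "col W 0 = c \<cdot>\<^sub>v v"
    using exists_unitary_first_col[OF v(1,2)] by blast
  define W' where "W' = mat_adjoint W"
  have W': "W' \<in> carrier_mat n n" "W' * W = 1\<^sub>m n"
    unfolding W'_def using W mat_adjoint_carrier by auto
  have WW': "W * W' = 1\<^sub>m n" using mat_mult_left_right_inverse[OF W'(1) W(1) W'(2)] .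
  define B where "B = W' * A * W"
  have B: "B \<in> carrier_mat n n" using A W W' by (simp add: B_def)
  have "mat_adjoint B = mat_adjoint W * mat_adjoint (W' * A)"
    unfolding B_def by (rule mat_adjoint_mult[of _ n n _ n]) (use A W W' in auto)
  also have "mat_adjoint (W' * A) = A * W"
    using mat_adjoint_mult[OF W'(1) A] herm by (simp add: W'_def mat_adjoint_adjoint)
  also have "mat_adjoint W * (A * W) = B"
    unfolding B_def W'_def[symmetric] using W'(1) A W(1) by (rule assoc_mult_mat[symmetric])
  finally have B_herm: "mat_adjoint B = B" .
  have "similar_mat_wit B A W' W"
    by (rule similar_mat_witI[of _ _ n]) (use W W' A B WW' in \<open>auto simp: B_def\<close>)
  then have cp_B: "char_poly B = char_poly A"
    using char_poly_similar unfolding similar_mat_def by blast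
  have "A *\<^sub>v col W 0 = e \<cdot>\<^sub>v col W 0"
    unfolding W0 using A v by (simp add: mult_mat_vec smult_smult_assoc mult.commute)
  moreover have "0 < n" using n by simp
  ultimately have "col (A * W) 0 = e \<cdot>\<^sub>v col W 0"
    using col_mult2[OF A W(1)] by simp
  moreover have "col B 0 = W' *\<^sub>v col (A * W) 0"
    unfolding B_def assoc_mult_mat[OF W'(1) A W(1)]
    using col_mult2[OF W'(1) mult_carrier_mat[OF A W(1)] \<open>0 < n\<close>] .
  ultimately have "col B 0 = W' *\<^sub>v (e \<cdot>\<^sub>v col W 0)" by simp
  also have "\<dots> = e \<cdot>\<^sub>v (W' *\<^sub>v col W 0)"
    using W(1) by (intro mult_mat_vec[OF W'(1)] col_carrier_vec[OF \<open>0 < n\<close>])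
  also have "W' *\<^sub>v col W 0 = col (W' * W) 0"
    using col_mult2[OF W'(1) W(1) \<open>0 < n\<close>] by simp
  also have "\<dots> = unit_vec n 0" unfolding W'(2) using n by simp
  finally have col_B: "col B 0 = e \<cdot>\<^sub>v unit_vec n 0" .
  have B_col: "B $$ (i, 0) = (if i = 0 then e else 0)" if "i < n" for i
    using arg_cong[OF col_B, of "\<lambda>v. v $ i"] B n that by simp
  have B_adj: "B $$ (i, j) = conjugate (B $$ (j, i))" if "i < n" "j < n" for i j
    using arg_cong[OF B_herm, of "\<lambda>X. X $$ (i, j)"] B that by simp
  define C where "C = mat k k (\<lambda>(i, j). B $$ (Suc i, Suc j))"
  define E where "E = mat 1 1 (\<lambda>_. e)"
  have C: "C \<in> carrier_mat k k" and E: "E \<in> carrier_mat 1 1" by (auto simp: C_def E_def)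
  \<comment> \<open>Hermitian symmetry turns the zeros below the corner into zeros to its
    right.\<close>
  have B_row: "B $$ (0, j) = 0" if "0 < j" "j < n" for j
    using B_adj[of 0 j] B_col[of j] that by simp
  have B_block: "B = four_block_mat E (0\<^sub>m 1 k) (0\<^sub>m k 1) C"
    using B n B_col B_row by (intro eq_matI) (auto simp: E_def C_def)
  have "char_poly E = [:- e, 1:]"
    by (simp add: E_def char_poly_defs det_def sign_def)
  then have "[:- e, 1:] * char_poly C = [:- e, 1:] * (\<Prod>e\<leftarrow>es. [:- e, 1:])"
    using char_poly_four_block_zeros_col[OF E _ C, of "0\<^sub>m 1 k"] cp cp_B B_block by simp
  then have cp_C: "char_poly C = (\<Prod>e\<leftarrow>es. [:- e, 1:])"
    by (metis mult_cancel_left pCons_eq_0_iff zero_neq_one)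
  have "mat_adjoint C = C"
    by (intro eq_matI) (auto simp: C_def n B_adj[symmetric])
  from Cons.IH[OF C this cp_C] obtain V where V: "V \<in> carrier_mat k k" "mat_adjoint V * V = 1\<^sub>m k"
    "mat_adjoint V * C * V = mat k k (\<lambda>(i, j). if i = j then es ! i else 0)" by blast
  define V' where "V' = mat_adjoint V"
  have V': "V' \<in> carrier_mat k k" unfolding V'_def using V(1) by (rule mat_adjoint_carrier)
  define F where "F = four_block_mat (1\<^sub>m 1) (0\<^sub>m 1 k) (0\<^sub>m k 1) V"
  define F' where "F' = four_block_mat (1\<^sub>m 1) (0\<^sub>m 1 k) (0\<^sub>m k 1) V'"
  have F: "F \<in> carrier_mat n n" and F': "F' \<in> carrier_mat n n"
    using V V' n by (auto simp: F_def F'_def)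
  have F'_adj: "F' = mat_adjoint F"
    using V n by (intro eq_matI) (auto simp: F_def F'_def V'_def conjugate_one)
  have F'F: "F' * F = 1\<^sub>m n"
  proof -
    have "F' * F = four_block_mat (1\<^sub>m 1) (0\<^sub>m 1 k) (0\<^sub>m k 1) (V' * V)"
      unfolding F_def F'_def using V V'
      by (subst mult_four_block_mat[of _ 1 1 _ k _ k _ _ 1 _ k]) auto
    also have "\<dots> = 1\<^sub>m n"
      unfolding V'_def V(2) using n by (intro eq_matI) auto
    finally show ?thesis .
  qed
  have F'BF: "F' * B * F = mat n n (\<lambda>(i, j). if i = j then (e # es) ! i else 0)"
  proof -
    have "F' * B = four_block_mat E (0\<^sub>m 1 k) (0\<^sub>m k 1) (V' * C)"
      unfolding B_block F'_def using V' C E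
      by (subst mult_four_block_mat[of _ 1 1 _ k _ k _ _ 1 _ k]) auto
    then have "F' * B * F = four_block_mat E (0\<^sub>m 1 k) (0\<^sub>m k 1) (V' * C * V)"
      unfolding F_def using V' C E V(1)
      by (simp, subst mult_four_block_mat[of _ 1 1 _ k _ k _ _ 1 _ k]) auto
    also have "\<dots> = mat n n (\<lambda>(i, j). if i = j then (e # es) ! i else 0)"
      unfolding V'_def V(3) using n by (intro eq_matI) (auto simp: E_def nth_Cons')
    finally show ?thesis .
  qed
  define U where "U = W * F"
  have U: "U \<in> carrier_mat n n" using W F by (simp add: U_def)
  have U': "mat_adjoint U = F' * W'"
    unfolding U_def F'_adj W'_def using W(1) F by (rule mat_adjoint_mult)
  have "mat_adjoint U * U = F' * (W' * (W * F))"
    unfolding U' using U unfolding U_def by (rule assoc_mult_mat[OF F' W'(1)])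
  also have "W' * (W * F) = F"
    unfolding assoc_mult_mat[OF W'(1) W(1) F, symmetric] W'(2) using F by simp
  finally have "mat_adjoint U * U = 1\<^sub>m n" unfolding F'F .
  moreover have "mat_adjoint U * A * U = F' * B * F"
  proof -
    have "mat_adjoint U * A = F' * (W' * A)"
      unfolding U' using A by (rule assoc_mult_mat[OF F' W'(1)])
    then have "mat_adjoint U * A * U = F' * (W' * A) * (W * F)" by (simp add: U_def)
    also have "\<dots> = F' * (W' * A) * W * F"
      using A W(1) W'(1) F F' by (intro assoc_mult_mat[symmetric]) auto
    also have "F' * (W' * A) * W = F' * B"
      unfolding B_def using A W(1) W'(1) F' by (intro assoc_mult_mat) auto
    finally show ?thesis .
  qed
  ultimately show ?case using U F'BF by auto
qed

text \<open>The fact that, beyond \<open>rc_field\<close>, is proved separately for the real and the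
  complex numbers. The type argument lets it appear as a hypothesis of the common
  development.\<close>

definition hermitian_splits :: "'a::rc_field itself \<Rightarrow> bool" where
  "hermitian_splits _ \<longleftrightarrow> (\<forall>n. \<forall>A :: 'a mat. A \<in> carrier_mat n n \<longrightarrow> mat_adjoint A = A \<longrightarrow>
    (\<exists>es. char_poly A = (\<Prod>e\<leftarrow>es. [:- e, 1:])))"

lemma hermitian_splits_complex: "hermitian_splits TYPE(complex)"
  unfolding hermitian_splits_def using char_poly_factorized by blast

text \<open>The eigenvalues form the diagonal of the matrix in an orthonormal basis, and that
  diagonal matrix is again Hermitian.\<close>

lemma hermitian_eigenvalues_real:
  fixes A :: "'a::rc_field mat"
  assumes A: "A \<in> carrier_mat n n" and herm: "mat_adjoint A = A"
    and cp: "char_poly A = (\<Prod>e\<leftarrow>es. [:- e, 1:])" and e: "e \<in> set es"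
  shows "conjugate e = e"
proof -
  obtain U where U: "U \<in> carrier_mat n n"
    "mat_adjoint U * A * U = mat n n (\<lambda>(i, j). if i = j then es ! i else 0)"
    using hermitian_unitary_diag[OF A herm cp] by blast
  define D where "D = mat_adjoint U * (A * U)"
  have U': "mat_adjoint U \<in> carrier_mat n n" using U(1) by (rule mat_adjoint_carrier)
  have D: "D = mat n n (\<lambda>(i, j). if i = j then es ! i else 0)"
    unfolding D_def using U(2) assoc_mult_mat[OF U' A U(1)] by simp
  have "mat_adjoint D = mat_adjoint (A * U) * mat_adjoint (mat_adjoint U)"
    unfolding D_def by (rule mat_adjoint_mult[OF U' mult_carrier_mat[OF A U(1)]])
  also have "\<dots> = mat_adjoint U * A * U"
    using mat_adjoint_mult[OF A U(1)] herm by (simp add: mat_adjoint_adjoint)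
  also have "\<dots> = D" unfolding U(2) D ..
  finally have D_herm: "mat_adjoint D = D" .
  have len: "length es = n"
    using degree_monic_char_poly[OF A] cp degree_prod_linear[of es] by simp
  obtain i where i: "i < n" "es ! i = e" using e len by (metis in_set_conv_nth)
  have "mat_adjoint D $$ (i, i) = conjugate (D $$ (i, i))" using i D by simp
  then show ?thesis unfolding D_herm using i by (simp add: D)
qed

text \<open>Over the complex numbers the characteristic polynomial splits with real roots. This
  factorization is the image of a real one, and the embedding of real polynomials is
  injective.\<close>

lemma hermitian_splits_real: "hermitian_splits TYPE(real)"
  unfolding hermitian_splits_def
proof (intro allI impI)
  fix n and A :: "real mat"
  assume A: "A \<in> carrier_mat n n" and herm: "mat_adjoint A = A"
  define B where "B = map_mat complex_of_real A"
  have B: "B \<in> carrier_mat n n" using A by (simp add: B_def)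
  have sym: "A $$ (j, i) = A $$ (i, j)" if "i < n" "j < n" for i j
    using arg_cong[OF herm, of "\<lambda>X. X $$ (i, j)"] A that by simp
  have "mat_adjoint B = B"
    using A sym by (intro eq_matI) (auto simp: B_def)
  moreover obtain es where cp: "char_poly B = (\<Prod>e\<leftarrow>es. [:- e, 1:])"
    using char_poly_factorized[OF B] by blast
  ultimately have real: "complex_of_real (Re e) = e" if "e \<in> set es" for e
    using hermitian_eigenvalues_real[OF B _ cp that] by (simp add: complex_eq_iff)
  interpret map_poly_inj_comm_ring_hom complex_of_real ..
  have "map_poly complex_of_real (char_poly A) = (\<Prod>e\<leftarrow>es. [:- e, 1:])"
    unfolding cp[symmetric] B_def by (rule of_real_hom.char_poly_hom[OF A, symmetric])
  also have "\<dots> = (\<Prod>e\<leftarrow>es. [:- complex_of_real (Re e), 1:])"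
    using real by (intro arg_cong[of _ _ prod_list] map_cong) auto
  also have "\<dots> = map_poly complex_of_real (\<Prod>e\<leftarrow>map Re es. [:- e, 1:])"
    by (simp add: hom_prod_list o_def)
  finally have "char_poly A = (\<Prod>e\<leftarrow>map Re es. [:- e, 1:])"
    by (simp only: eq_iff)
  then show "\<exists>es. char_poly A = (\<Prod>e\<leftarrow>es. [:- e, 1:])" by blast
qed

section \<open>Singular values as bounds for the length of \<open>y B\<close>\<close>

lemma index_mult_mat_sum:
  assumes "A \<in> carrier_mat p q" and "B \<in> carrier_mat q r" and "i < p" and "l < r"
  shows "(A * B) $$ (i, l) = (\<Sum>j<q. A $$ (i, j) * B $$ (j, l))"
  using assms by (simp add: scalar_prod_def atLeast0LessThan)

text \<open>Connects lengths of row combinations with the matrix whose eigenvalues define the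
  singular values.\<close>

lemma sum_norm_row_comb:
  fixes C :: "'a::rc_field mat"
  assumes C: "C \<in> carrier_mat p r"
  shows "of_real (\<Sum>j<r. (norm (row_comb C y j))\<^sup>2)
    = (\<Sum>i<p. \<Sum>l<p. y i * conjugate (y l) * (C * mat_adjoint C) $$ (i, l))"
proof -
  have row_comb: "row_comb C y j = (\<Sum>i<p. y i * C $$ (i, j))" for j
    using C by (simp add: row_comb_def)
  have "row_comb C y j * conjugate (row_comb C y j)
      = (\<Sum>i<p. \<Sum>l<p. y i * conjugate (y l) * (C $$ (i, j) * conjugate (C $$ (l, j))))" for j
    unfolding row_comb sum_conjugate[OF finite_lessThan] conjugate_dist_mul sum_product
    by (intro sum.cong refl) (simp only: mult_ac)
  then have "of_real (\<Sum>j<r. (norm (row_comb C y j))\<^sup>2)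
      = (\<Sum>j<r. \<Sum>i<p. \<Sum>l<p. y i * conjugate (y l) * (C $$ (i, j) * conjugate (C $$ (l, j))))"
    unfolding of_real_sum mult_conjugate[symmetric] by simp
  also have "\<dots> = (\<Sum>i<p. \<Sum>l<p. \<Sum>j<r. y i * conjugate (y l) * (C $$ (i, j) * conjugate (C $$ (l, j))))"
    by (subst sum.swap, rule sum.cong[OF refl], rule sum.swap)
  also have "\<dots> = (\<Sum>i<p. \<Sum>l<p. y i * conjugate (y l) * (C * mat_adjoint C) $$ (i, l))"
  proof (intro sum.cong refl)
    fix i l assume "i \<in> {..<p}" "l \<in> {..<p}"
    then have "(C * mat_adjoint C) $$ (i, l) = (\<Sum>j<r. C $$ (i, j) * conjugate (C $$ (l, j)))"
      using C by (simp add: scalar_prod_def atLeast0LessThan)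
    then show "(\<Sum>j<r. y i * conjugate (y l) * (C $$ (i, j) * conjugate (C $$ (l, j))))
        = y i * conjugate (y l) * (C * mat_adjoint C) $$ (i, l)"
      by (simp only: sum_distrib_left)
  qed
  finally show ?thesis .
qed

text \<open>The row half of a singular value decomposition. With \<open>U\<close> diagonalizing
  \<open>B * mat_adjoint B\<close> and \<open>z y = y U\<close>, the values \<open>ss ! i\<close>
  are the stretching factors along the coordinates of \<open>z\<close>. The last clause, that every
  coordinate vector is attained, serves to make upper bounds sharp.\<close>

lemma singular_values_diagonalization:
  fixes B :: "'a::rc_field mat"
  assumes splits: "hermitian_splits TYPE('a)" and B: "B \<in> carrier_mat p q"
  shows "\<exists>ss z. length ss = p \<and> (\<forall>s\<in>set ss. 0 \<le> s)
    \<and> singular_values B = take (min p q) (rev (sort ss))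
    \<and> (\<forall>y. (\<Sum>j<q. (norm (row_comb B y j))\<^sup>2) = (\<Sum>i<p. (ss ! i)\<^sup>2 * (norm (z y i :: 'a))\<^sup>2))
    \<and> (\<forall>y. (\<Sum>i<p. (norm (z y i))\<^sup>2) = (\<Sum>i<p. (norm (y i))\<^sup>2))
    \<and> (\<forall>i<p. \<exists>y. \<forall>j<p. z y j = (if j = i then 1 else 0))"
proof -
  define A where "A = B * mat_adjoint B"
  have B': "mat_adjoint B \<in> carrier_mat q p" using B by (rule mat_adjoint_carrier)
  have A: "A \<in> carrier_mat p p" using B B' by (simp add: A_def)
  have herm: "mat_adjoint A = A"
    unfolding A_def mat_adjoint_mult[OF B B'] mat_adjoint_adjoint ..
  obtain es where cp: "char_poly A = (\<Prod>e\<leftarrow>es. [:- e, 1:])"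
    using splits A herm unfolding hermitian_splits_def by blast
  have len: "length es = p"
    using degree_monic_char_poly[OF A] cp degree_prod_linear[of es] by simp
  obtain U where U: "U \<in> carrier_mat p p" "mat_adjoint U * U = 1\<^sub>m p"
    and diag: "mat_adjoint U * A * U = mat p p (\<lambda>(i, j). if i = j then es ! i else 0)"
    using hermitian_unitary_diag[OF A herm cp] by blast
  have U': "mat_adjoint U \<in> carrier_mat p p" using U(1) by (rule mat_adjoint_carrier)
  have UU': "U * mat_adjoint U = 1\<^sub>m p"
    using mat_mult_left_right_inverse[OF U' U(1) U(2)] .
  have isometry: "(\<Sum>i<p. (norm (row_comb U y i))\<^sup>2) = (\<Sum>i<p. (norm (y i))\<^sup>2)" for y
  proof -
    have "of_real (\<Sum>i<p. (norm (row_comb U y i))\<^sup>2) = (of_real (\<Sum>i<p. (norm (y i))\<^sup>2) :: 'a)"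
    proof -
      have "(\<Sum>l<p. y i * conjugate (y l) * 1\<^sub>m p $$ (i, l)) = of_real ((norm (y i))\<^sup>2)" if "i < p" for i
      proof -
        have "(\<Sum>l<p. y i * conjugate (y l) * 1\<^sub>m p $$ (i, l))
            = (\<Sum>l<p. if l = i then y i * conjugate (y i) else 0)"
          using that by (intro sum.cong refl) auto
        then show ?thesis using that unfolding mult_conjugate by simp
      qed
      then show ?thesis
        unfolding sum_norm_row_comb[OF U(1)] UU' unfolding of_real_sum by (intro sum.cong refl) simp
    qed
    then show ?thesis by (simp only: of_real_eq_iff)
  qed
  define E where "E = mat p p (\<lambda>(i, j). if i = j then es ! i else 0)"
  have E: "E \<in> carrier_mat p p" by (simp add: E_def)
  have A_eq: "A = U * E * mat_adjoint U"
  proof -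
    have "U * E = U * (mat_adjoint U * (A * U))"
      unfolding E_def diag[symmetric] assoc_mult_mat[OF U' A U(1)] ..
    also have "\<dots> = A * U"
      unfolding assoc_mult_mat[OF U(1) U' mult_carrier_mat[OF A U(1)], symmetric] UU'
      by (rule left_mult_one_mat[OF mult_carrier_mat[OF A U(1)]])
    finally have "U * E * mat_adjoint U = A * (U * mat_adjoint U)"
      using assoc_mult_mat[OF A U(1) U'] by simp
    then show ?thesis unfolding UU' using A by simp
  qed
  have A_entry: "A $$ (i, l) = (\<Sum>j<p. es ! j * (U $$ (i, j) * conjugate (U $$ (l, j))))"
    if "i < p" "l < p" for i l
  proof -
    have UE: "(U * E) $$ (i, j) = U $$ (i, j) * es ! j" if "j < p" for j
    proof -
      have "(U * E) $$ (i, j) = (\<Sum>k<p. U $$ (i, k) * E $$ (k, j))"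
        by (rule index_mult_mat_sum[OF U(1) E \<open>i < p\<close> that])
      also have "\<dots> = (\<Sum>k<p. if k = j then U $$ (i, j) * es ! j else 0)"
        using that by (intro sum.cong refl) (auto simp: E_def)
      finally show ?thesis using that by simp
    qed
    have "A $$ (i, l) = (\<Sum>j<p. (U * E) $$ (i, j) * mat_adjoint U $$ (j, l))"
      unfolding A_eq by (rule index_mult_mat_sum[OF mult_carrier_mat[OF U(1) E] U' that])
    also have "\<dots> = (\<Sum>j<p. es ! j * (U $$ (i, j) * conjugate (U $$ (l, j))))"
      using that U(1) by (intro sum.cong refl) (simp add: UE mult_ac)
    finally show ?thesis .
  qed
  have energy: "of_real (\<Sum>j<q. (norm (row_comb B y j))\<^sup>2)
      = (\<Sum>j<p. es ! j * of_real ((norm (row_comb U y j))\<^sup>2))" for y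
  proof -
    let ?t = "\<lambda>i l j. es ! j * ((y i * U $$ (i, j)) * (conjugate (y l) * conjugate (U $$ (l, j))))"
    have summand: "y i * conjugate (y l) * A $$ (i, l) = (\<Sum>j<p. ?t i l j)" if "i < p" "l < p" for i l
      unfolding A_entry[OF that] sum_distrib_left by (intro sum.cong refl) (simp only: mult_ac)
    have "of_real (\<Sum>j<q. (norm (row_comb B y j))\<^sup>2) = (\<Sum>i<p. \<Sum>l<p. \<Sum>j<p. ?t i l j)"
      unfolding sum_norm_row_comb[OF B] A_def[symmetric] using summand by (intro sum.cong refl) simp
    also have "\<dots> = (\<Sum>i<p. \<Sum>j<p. \<Sum>l<p. ?t i l j)"
      by (intro sum.cong refl sum.swap)
    also have "\<dots> = (\<Sum>j<p. \<Sum>i<p. \<Sum>l<p. ?t i l j)"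
      by (rule sum.swap)
    also have "\<dots> = (\<Sum>j<p. es ! j * of_real ((norm (row_comb U y j))\<^sup>2))"
    proof (intro sum.cong refl)
      fix j
      have "row_comb U y j = (\<Sum>i<p. y i * U $$ (i, j))" using U(1) by (simp add: row_comb_def)
      then have "of_real ((norm (row_comb U y j))\<^sup>2)
          = (\<Sum>i<p. \<Sum>l<p. (y i * U $$ (i, j)) * (conjugate (y l) * conjugate (U $$ (l, j))))"
        unfolding mult_conjugate[symmetric]
        by (simp only: sum_conjugate[OF finite_lessThan] conjugate_dist_mul sum_product)
      then show "(\<Sum>i<p. \<Sum>l<p. ?t i l j) = es ! j * of_real ((norm (row_comb U y j))\<^sup>2)"
        by (simp only: sum_distrib_left)
    qed
    finally show ?thesis .
  qed
  have unit: "\<exists>y. \<forall>j<p. row_comb U y j = (if j = i then 1 else 0)" if "i < p" for i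
  proof (intro exI allI impI)
    fix j assume j: "j < p"
    have "row_comb U (\<lambda>l. conjugate (U $$ (l, i))) j = (mat_adjoint U * U) $$ (i, j)"
      using that j U(1) by (simp add: row_comb_def scalar_prod_def atLeast0LessThan)
    then show "row_comb U (\<lambda>l. conjugate (U $$ (l, i))) j = (if j = i then 1 else 0)"
      unfolding U(2) using that j by auto
  qed
  \<comment> \<open>The squared length of \<open>y B\<close> at the row sent to coordinate vector
    \<open>i\<close> is \<open>es ! i\<close>, which is therefore a nonnegative real. So
    \<open>norm\<close> in \<open>singular_values\<close> does not alter the eigenvalues.\<close>
  have es_norm: "es ! i = of_real (norm (es ! i))" if i: "i < p" for i
  proof -
    obtain y where y: "\<forall>j<p. row_comb U y j = (if j = i then 1 else 0)"
      using unit[OF i] by blast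
    have "of_real (\<Sum>j<q. (norm (row_comb B y j))\<^sup>2) = (\<Sum>j<p. if j = i then es ! j else 0)"
      unfolding energy using y by (intro sum.cong) auto
    also have "\<dots> = es ! i" using i by simp
    finally have "es ! i = of_real (\<Sum>j<q. (norm (row_comb B y j))\<^sup>2)" ..
    moreover have "0 \<le> (\<Sum>j<q. (norm (row_comb B y j))\<^sup>2)" by (simp add: sum_nonneg)
    ultimately show ?thesis by (simp only: norm_of_real abs_of_nonneg)
  qed
  define ss where "ss = map (\<lambda>x. sqrt (norm x)) es"
  have "(\<Sum>j<q. (norm (row_comb B y j))\<^sup>2) = (\<Sum>i<p. (ss ! i)\<^sup>2 * (norm (row_comb U y i))\<^sup>2)" for y
  proof -
    have "of_real (\<Sum>j<q. (norm (row_comb B y j))\<^sup>2)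
        = (\<Sum>j<p. of_real (norm (es ! j)) * (of_real ((norm (row_comb U y j))\<^sup>2) :: 'a))"
      unfolding energy by (intro sum.cong refl) (simp only: es_norm[symmetric] lessThan_iff)
    also have "\<dots> = of_real (\<Sum>j<p. norm (es ! j) * (norm (row_comb U y j))\<^sup>2)"
      by simp
    finally have "(\<Sum>j<q. (norm (row_comb B y j))\<^sup>2) = (\<Sum>j<p. norm (es ! j) * (norm (row_comb U y j))\<^sup>2)"
      by (simp only: of_real_eq_iff)
    then show ?thesis by (simp add: ss_def len)
  qed
  moreover have "singular_values B = take (min p q) (rev (sort ss))"
    unfolding singular_values_def A_def[symmetric] cp proots_prod_linear ss_def
    using B by (simp flip: mset_map)
  moreover have "length ss = p" "\<forall>s\<in>set ss. 0 \<le> s" by (auto simp: ss_def len)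
  ultimately show ?thesis using isometry unit by blast
qed

context
  fixes B :: "'a::rc_field mat" and p q :: nat
  assumes splits: "hermitian_splits TYPE('a)" and B: "B \<in> carrier_mat p q"
begin

text \<open>For \<open>p <= q\<close> the list of singular values is not truncated, so the one
  numbered \<open>p\<close> is the least of the \<open>p\<close> stretching factors.\<close>

lemma singular_value_lower:
  assumes p: "0 < p" "p \<le> q"
  shows "0 \<le> singular_value p B"
    and "(singular_value p B)\<^sup>2 * (\<Sum>i<p. (norm (y i))\<^sup>2) \<le> (\<Sum>j<q. (norm (row_comb B y j))\<^sup>2)"
proof -
  obtain ss z where ss: "length ss = p" "\<forall>s\<in>set ss. 0 \<le> s"
      "singular_values B = take (min p q) (rev (sort ss))"
    and energy: "(\<Sum>j<q. (norm (row_comb B y j))\<^sup>2) = (\<Sum>i<p. (ss ! i)\<^sup>2 * (norm (z y i :: 'a))\<^sup>2)"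
    and isometry: "(\<Sum>i<p. (norm (z y i))\<^sup>2) = (\<Sum>i<p. (norm (y i))\<^sup>2)"
    using singular_values_diagonalization[OF splits B] by blast
  have sv: "singular_value p B = sort ss ! 0"
    using p ss(1,3) by (simp add: singular_value_def rev_nth)
  have "sort ss ! 0 \<in> set (sort ss)" using p ss(1) by (intro nth_mem) simp
  then show nonneg: "0 \<le> singular_value p B" unfolding sv using ss(2) by simp
  have le: "singular_value p B \<le> ss ! i" if "i < p" for i
  proof -
    have "ss ! i \<in> set (sort ss)" using that ss(1) by simp
    then obtain l where "l < length (sort ss)" "sort ss ! l = ss ! i" by (auto simp only: in_set_conv_nth)
    then show ?thesis unfolding sv using sorted_nth_mono[of "sort ss" 0 l] by simp
  qed
  have "(singular_value p B)\<^sup>2 * (\<Sum>i<p. (norm (z y i))\<^sup>2) \<le> (\<Sum>i<p. (ss ! i)\<^sup>2 * (norm (z y i))\<^sup>2)"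
    unfolding sum_distrib_left using le nonneg by (intro sum_mono mult_right_mono power_mono) auto
  then show "(singular_value p B)\<^sup>2 * (\<Sum>i<p. (norm (y i))\<^sup>2) \<le> (\<Sum>j<q. (norm (row_comb B y j))\<^sup>2)"
    unfolding energy isometry .
qed

text \<open>The first singular value is the largest stretching factor. The coordinate vector that
  belongs to it shows that its square is the best constant, which is the third claim.\<close>

lemma spectral_norm_upper:
  assumes pq: "0 < p" "0 < q"
  shows "0 \<le> spectral_norm B"
    and "(\<Sum>j<q. (norm (row_comb B y j))\<^sup>2) \<le> (spectral_norm B)\<^sup>2 * (\<Sum>i<p. (norm (y i))\<^sup>2)"
    and "(\<And>y. (\<Sum>j<q. (norm (row_comb B y j))\<^sup>2) \<le> c * (\<Sum>i<p. (norm (y i))\<^sup>2)) \<Longrightarrow>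
      (spectral_norm B)\<^sup>2 \<le> c"
proof -
  obtain ss z where ss: "length ss = p" "\<forall>s\<in>set ss. 0 \<le> s"
      "singular_values B = take (min p q) (rev (sort ss))"
    and energy: "\<forall>y. (\<Sum>j<q. (norm (row_comb B y j))\<^sup>2) = (\<Sum>i<p. (ss ! i)\<^sup>2 * (norm (z y i :: 'a))\<^sup>2)"
    and isometry: "\<forall>y. (\<Sum>i<p. (norm (z y i))\<^sup>2) = (\<Sum>i<p. (norm (y i))\<^sup>2)"
    and unit: "\<forall>i<p. \<exists>y. \<forall>j<p. z y j = (if j = i then 1 else 0)"
    using singular_values_diagonalization[OF splits B] by blast
  have sv: "spectral_norm B = sort ss ! (p - 1)"
    using pq ss(1,3) by (simp add: spectral_norm_def singular_value_def rev_nth)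
  have "sort ss ! (p - 1) \<in> set (sort ss)" using pq ss(1) by (intro nth_mem) simp
  then have "spectral_norm B \<in> set ss" unfolding sv by simp
  then show "0 \<le> spectral_norm B" using ss(2) by simp
  have le: "ss ! i \<le> spectral_norm B" "0 \<le> ss ! i" if "i < p" for i
  proof -
    have "ss ! i \<in> set (sort ss)" using that ss(1) by simp
    then obtain l where "l < length (sort ss)" "sort ss ! l = ss ! i" by (auto simp only: in_set_conv_nth)
    then show "ss ! i \<le> spectral_norm B"
      unfolding sv using sorted_nth_mono[of "sort ss" l "p - 1"] ss(1) by simp
    show "0 \<le> ss ! i" using that ss by simp
  qed
  have "(\<Sum>i<p. (ss ! i)\<^sup>2 * (norm (z y i))\<^sup>2) \<le> (spectral_norm B)\<^sup>2 * (\<Sum>i<p. (norm (z y i))\<^sup>2)"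
    unfolding sum_distrib_left using le by (intro sum_mono mult_right_mono power_mono) auto
  then show "(\<Sum>j<q. (norm (row_comb B y j))\<^sup>2) \<le> (spectral_norm B)\<^sup>2 * (\<Sum>i<p. (norm (y i))\<^sup>2)"
    using energy isometry by simp
  assume bound: "\<And>y. (\<Sum>j<q. (norm (row_comb B y j))\<^sup>2) \<le> c * (\<Sum>i<p. (norm (y i))\<^sup>2)"
  obtain i where i: "i < p" "ss ! i = spectral_norm B"
    using \<open>spectral_norm B \<in> set ss\<close> ss(1) by (auto simp only: in_set_conv_nth)
  then obtain y where y: "\<forall>j<p. z y j = (if j = i then 1 else 0)" using unit by blast
  have "(\<Sum>j<p. (ss ! j)\<^sup>2 * (norm (z y j))\<^sup>2) = (\<Sum>j<p. if j = i then (spectral_norm B)\<^sup>2 else 0)"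
    using y i by (intro sum.cong refl) auto
  moreover have "(\<Sum>j<p. (norm (z y j))\<^sup>2) = (\<Sum>j<p. if j = i then 1 else 0)"
    using y by (intro sum.cong refl) auto
  ultimately show "(spectral_norm B)\<^sup>2 \<le> c"
    using bound[of y] energy isometry i by simp
qed

end

subsection \<open>Perturbations\<close>

lemma poly_mats_diff:
  fixes M M' :: "'a::ring poly mat"
  assumes "M \<in> poly_mats m q d" and "M' \<in> poly_mats m q d"
  shows "M - M' \<in> poly_mats m q d"
  using assms by (auto simp: poly_mats_def intro!: degree_diff_le)

lemma sylvester_diff:
  fixes M M' :: "'a::ring poly mat"
  assumes "M \<in> carrier_mat m q" and "M' \<in> carrier_mat m q"
  shows "sylvester d k M - sylvester d k M' = sylvester d k (M - M')"
proof (rule eq_matI)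
  fix i j assume "i < dim_row (sylvester d k (M - M'))" "j < dim_col (sylvester d k (M - M'))"
  then have ij: "i < (k + d) * m" "j < k * q"
    using assms by (auto simp: sylvester_def Let_def)
  then have "0 < m" "0 < q" by (auto intro!: Nat.gr0I)
  then have "i mod m < m" "j mod q < q" by simp_all
  then show "(sylvester d k M - sylvester d k M') $$ (i, j) = sylvester d k (M - M') $$ (i, j)"
    using ij assms by (auto simp: sylvester_def Let_def coeff_mat_def)
qed (use assms in \<open>auto simp: sylvester_def Let_def\<close>)

lemma row_comb_diff:
  fixes A B :: "'a::comm_ring_1 mat"
  assumes "A \<in> carrier_mat p q" and "B \<in> carrier_mat p q" and "j < q"
  shows "row_comb (A - B) y j = row_comb A y j - row_comb B y j"
  using assms by (simp add: row_comb_def right_diff_distrib sum_subtractf)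

text \<open>Block column \<open>b\<close> of \<open>S_k(D)\<close> is the single block column
  \<open>S_1(D)\<close> moved down by \<open>b\<close> blocks, so it meets only the
  \<open>(1 + d) m\<close> entries of \<open>y\<close> from \<open>b * m\<close> on.\<close>

lemma row_comb_sylvester_shift:
  fixes D :: "'a::comm_ring_1 poly mat"
  assumes D: "D \<in> carrier_mat m q" and b: "b < k" and j: "j < q"
  shows "row_comb (sylvester d k D) y (b * q + j) = row_comb (sylvester d 1 D) (\<lambda>u. y (b * m + u)) j"
proof -
  let ?g = "\<lambda>a. \<Sum>i<m. y (a * m + i) * (if b \<le> a \<and> a - b \<le> d then coeff (D $$ (i, j)) (a - b) else 0)"
  have "row_comb (sylvester d k D) y (b * q + j)
      = (\<Sum>a<k + d. \<Sum>i<m. y (a * m + i) * sylvester d k D $$ (a * m + i, b * q + j))"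
    using sylvester_carrier[OF D, of d k] by (simp add: row_comb_def sum_lessThan_mult)
  also have "\<dots> = (\<Sum>a<k + d. ?g a)"
    using D b j by (intro sum.cong refl) (simp add: sylvester_index)
  also have "\<dots> = (\<Sum>a\<in>{b..<b + (1 + d)}. ?g a)"
    using b by (intro sum.mono_neutral_right) auto
  also have "\<dots> = (\<Sum>a<1 + d. ?g (b + a))"
    using sum.shift_bounds_nat_ivl[of ?g 0 b "1 + d"] by (simp only: atLeast0LessThan add.commute add_0)
  also have "\<dots> = (\<Sum>a<1 + d. \<Sum>i<m. y (b * m + (a * m + i)) * sylvester d 1 D $$ (a * m + i, 0 * q + j))"
    by (intro sum.cong refl) (use sylvester_index[OF D, where k = 1 and b = 0] j in
        \<open>simp add: algebra_simps\<close>)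
  also have "\<dots> = row_comb (sylvester d 1 D) (\<lambda>u. y (b * m + u)) j"
    unfolding row_comb_def carrier_matD(1)[OF sylvester_carrier[OF D]] sum_lessThan_mult
    by (simp only: mult_0 add_0)
  finally show ?thesis .
qed

text \<open>The squared form of the bound of \<open>S_k(D)\<close> by \<open>sqrt k\<close> times
  the norm of \<open>S_1(D)\<close>: each of the \<open>k\<close> block columns acts as
  \<open>S_1(D)\<close> on a window of \<open>y\<close>, whose Euclidean length is at most that of
  \<open>y\<close>.\<close>

lemma sylvester_energy_le:
  fixes D :: "'a::rc_field poly mat"
  assumes splits: "hermitian_splits TYPE('a)" and D: "D \<in> carrier_mat m q" and mq: "0 < m" "0 < q"
  shows "(\<Sum>t<k * q. (norm (row_comb (sylvester d k D) y t))\<^sup>2)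
    \<le> real k * (spectral_norm (sylvester d 1 D))\<^sup>2 * (\<Sum>u<(k + d) * m. (norm (y u))\<^sup>2)"
proof -
  let ?s = "(spectral_norm (sylvester d 1 D))\<^sup>2" and ?E = "\<Sum>u<(k + d) * m. (norm (y u))\<^sup>2"
  have block: "(\<Sum>j<q. (norm (row_comb (sylvester d k D) y (b * q + j)))\<^sup>2) \<le> ?s * ?E" if b: "b < k" for b
  proof -
    have "(\<Sum>j<q. (norm (row_comb (sylvester d k D) y (b * q + j)))\<^sup>2)
        = (\<Sum>j<1 * q. (norm (row_comb (sylvester d 1 D) (\<lambda>u. y (b * m + u)) j))\<^sup>2)"
      using row_comb_sylvester_shift[OF D b] by (intro sum.cong) auto
    also have "\<dots> \<le> ?s * (\<Sum>u<(1 + d) * m. (norm (y (b * m + u)))\<^sup>2)"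
      using mq by (intro spectral_norm_upper(2)[OF splits sylvester_carrier[OF D]]) auto
    also have "(\<Sum>u<(1 + d) * m. (norm (y (b * m + u)))\<^sup>2)
        = (\<Sum>u\<in>(\<lambda>u. b * m + u) ` {..<(1 + d) * m}. (norm (y u))\<^sup>2)"
      by (subst sum.reindex) (auto simp: inj_on_def)
    also have "?s * \<dots> \<le> ?s * ?E"
    proof (intro mult_left_mono sum_mono2)
      have "(b + (1 + d)) * m \<le> (k + d) * m" using b by (intro mult_le_mono1) simp
      then show "(\<lambda>u. b * m + u) ` {..<(1 + d) * m} \<subseteq> {..<(k + d) * m}"
        by (auto simp: distrib_right)
    qed auto
    finally show ?thesis .
  qed
  have "(\<Sum>t<k * q. (norm (row_comb (sylvester d k D) y t))\<^sup>2)
      = (\<Sum>b<k. \<Sum>j<q. (norm (row_comb (sylvester d k D) y (b * q + j)))\<^sup>2)"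
    by (rule sum_lessThan_mult)
  also have "\<dots> \<le> (\<Sum>b<k. ?s * ?E)" using block by (intro sum_mono) auto
  finally show ?thesis by (simp add: mult.assoc)
qed

lemma full_row_rank_iff: "full_row_rank A \<longleftrightarrow> left_injective A"
  unfolding full_row_rank_def by (rule mat_rank_eq_dim_row_iff) auto

text \<open>A left null vector \<open>y\<close> of \<open>S_k(M')\<close> satisfies
  \<open>y S_k(M) = y S_k(M - M')\<close>. The left side has length at least
  \<open>\<sigma> |y|\<close>, the right side at most \<open>sqrt k s |y|\<close>, which the
  assumption makes smaller.\<close>

lemma sylvester_perturbation:
  fixes M M' :: "'a::rc_field poly mat"
  assumes splits: "hermitian_splits TYPE('a)"
    and M: "M \<in> carrier_mat m q" and M': "M' \<in> carrier_mat m q"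
    and pos: "0 < m" "0 < q" "0 < k"
    and full: "full_row_rank (sylvester d k M)"
    and less: "spectral_norm (sylvester d 1 M - sylvester d 1 M')
      < singular_value ((k + d) * m) (sylvester d k M) / sqrt (real k)"
  shows "left_injective (sylvester d k M')"
proof (rule ccontr)
  define N where "N = (k + d) * m"
  define \<sigma> where "\<sigma> = singular_value N (sylvester d k M)"
  define s where "s = spectral_norm (sylvester d 1 (M - M'))"
  have D: "M - M' \<in> carrier_mat m q" using M M' by auto
  have S: "sylvester d k M \<in> carrier_mat N (k * q)" and S': "sylvester d k M' \<in> carrier_mat N (k * q)"
    using sylvester_carrier M M' by (auto simp: N_def)
  have N: "0 < N" using pos by (simp add: N_def)
  \<comment> \<open>Full row rank needs at least as many columns as rows, so \<open>\<sigma>\<close>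
    is the least singular value.\<close>
  have "N \<le> k * q"
    using full vec_space.rank_le_nc[OF S] S by (simp add: full_row_rank_def)
  note lower = singular_value_lower[OF splits S N this, folded \<sigma>_def]
  have s0: "0 \<le> s"
    unfolding s_def using pos
    by (intro spectral_norm_upper(1)[OF splits sylvester_carrier[OF D]]) auto
  have "s < \<sigma> / sqrt (real k)"
    using less sylvester_diff[OF M M', of d 1] by (simp add: s_def \<sigma>_def N_def)
  then have "s * sqrt (real k) < \<sigma>" using pos by (simp add: pos_less_divide_eq)
  then have "(s * sqrt (real k))\<^sup>2 < \<sigma>\<^sup>2" using s0 by (intro power_strict_mono) auto
  then have lt: "real k * s\<^sup>2 < \<sigma>\<^sup>2" by (simp add: power_mult_distrib mult.commute)
  assume "\<not> left_injective (sylvester d k M')"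
  then obtain y i where y: "\<forall>t<k * q. row_comb (sylvester d k M') y t = 0" and i: "i < N" "y i \<noteq> 0"
    using S' by (auto simp: left_injective_def)
  define E where "E = (\<Sum>u<N. (norm (y u))\<^sup>2)"
  have "0 < (norm (y i))\<^sup>2" using i by simp
  also have "\<dots> \<le> E" unfolding E_def using i by (intro member_le_sum) auto
  finally have E: "0 < E" .
  have "row_comb (sylvester d k M) y t = row_comb (sylvester d k (M - M')) y t" if "t < k * q" for t
    using row_comb_diff[OF S S' that, of y] y that unfolding sylvester_diff[OF M M'] by simp
  then have "\<sigma>\<^sup>2 * E \<le> (\<Sum>t<k * q. (norm (row_comb (sylvester d k (M - M')) y t))\<^sup>2)"
    using lower(2)[of y] by (simp add: E_def)
  also have "\<dots> \<le> real k * s\<^sup>2 * E"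
    using sylvester_energy_le[OF splits D pos(1,2), of d k y] by (simp add: s_def E_def N_def)
  finally show False using lt E by simp
qed


section \<open>Nearby matrices that are not minimal bases\<close>

lemma norm_poly_of_real_le:
  fixes P :: "'a::real_normed_field poly"
  assumes P: "degree_less P d" and d: "0 < d" and T: "1 \<le> T"
  shows "norm (poly P (of_real T)) \<le> (\<Sum>l<d. norm (coeff P l)) * T ^ (d - 1)"
proof -
  have "degree P < d" using P d by (auto simp: degree_less_iff)
  then have "poly P (of_real T) = (\<Sum>l<d. coeff P l * of_real T ^ l)"
    unfolding poly_altdef by (intro sum.mono_neutral_left) (auto simp: coeff_eq_0)
  then have "norm (poly P (of_real T)) \<le> (\<Sum>l<d. norm (coeff P l * of_real T ^ l))"
    by (simp only: norm_sum)
  also have "\<dots> \<le> (\<Sum>l<d. norm (coeff P l) * T ^ (d - 1))"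
  proof (intro sum_mono)
    fix l assume "l \<in> {..<d}"
    then have "T ^ l \<le> T ^ (d - 1)" using T by (intro power_increasing) auto
    then show "norm (coeff P l * of_real T ^ l) \<le> norm (coeff P l) * T ^ (d - 1)"
      using T by (auto simp: norm_mult norm_power intro: mult_left_mono)
  qed
  finally show ?thesis by (simp add: sum_distrib_right)
qed

text \<open>A combination of the rows with constant coefficients that vanishes at \<open>t\<close> is divisible by
  \<open>x - t\<close>, and the quotient has smaller degree than one of the rows involved.\<close>

lemma not_minimal_basis_of_zero:
  fixes M :: "'a::field poly mat"
  assumes M: "M \<in> carrier_mat m q" and i0: "i0 < m" "v i0 \<noteq> 0"
    and zero: "\<And>j. j < q \<Longrightarrow> poly (row_comb M (\<lambda>i. [:v i:]) j) t = 0"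
  shows "\<not> minimal_basis M"
proof
  assume min: "minimal_basis M"
  let ?I = "{i. i < m \<and> v i \<noteq> 0}"
  have "finite ?I" "?I \<noteq> {}" using i0 by auto
  then have "Max ((\<lambda>l. vec_degree (row M l)) ` ?I) \<in> (\<lambda>l. vec_degree (row M l)) ` ?I"
    by (intro Max_in) auto
  \<comment> \<open>Among the rows with nonzero coefficient, one of largest degree is to be
    replaced: it bounds the degree of the whole combination, and the quotient by the linear factor
    loses one degree.\<close>
  then obtain i where i: "i \<in> ?I" and "Max ((\<lambda>l. vec_degree (row M l)) ` ?I) = vec_degree (row M i)"
    by blast
  then have max: "vec_degree (row M l) \<le> vec_degree (row M i)" if "l \<in> ?I" for l
    using Max_ge[of "(\<lambda>l. vec_degree (row M l)) ` ?I" "vec_degree (row M l)"] that by simp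
  define w where "w j = row_comb M (\<lambda>i. [:v i:]) j div [:- t, 1:]" for j
  have w: "[:- t, 1:] * w j = row_comb M (\<lambda>i. [:v i:]) j" if "j < q" for j
    using zero[OF that] unfolding w_def poly_eq_0_iff_dvd by (rule dvd_mult_div_cancel)
  obtain j where j: "j < q" "w j \<noteq> 0" "vec_degree (row M i) \<le> degree (w j)"
    using minimal_basis_row_degree_le[OF M min, of i "[:- t, 1:]" "\<lambda>i. [:v i:]" w] i w by auto
  have "degree ([:v l:] * M $$ (l, j)) \<le> vec_degree (row M i)" if l: "l < m" for l
  proof (cases "v l = 0")
    case False
    have "degree ([:v l:] * M $$ (l, j)) \<le> degree (row M l $ j)"
      using l j(1) M by (simp add: degree_smult_le)
    also have "\<dots> \<le> vec_degree (row M l)" using l j(1) M by (intro degree_le_vec_degree) auto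
    also have "\<dots> \<le> vec_degree (row M i)" using max l False by simp
    finally show ?thesis .
  qed simp
  then have "degree (row_comb M (\<lambda>i. [:v i:]) j) \<le> vec_degree (row M i)"
    unfolding row_comb_def using M by (intro degree_sum_le) auto
  moreover have "degree (row_comb M (\<lambda>i. [:v i:]) j) = Suc (degree (w j))"
    unfolding w[OF j(1), symmetric] using j(2) by (subst degree_mult_eq) auto
  ultimately show False using j(3) by simp
qed

text \<open>Only row \<open>i0\<close> of the leading coefficient is changed, by entries
  \<open>c j\<close> that make \<open>v M'\<close> vanish at \<open>t\<close>. As
  \<open>v i0\<close> is nonzero, \<open>c j\<close> can be solved for.\<close>

lemma nearby_not_minimal_basis:
  fixes M :: "'a::rc_field poly mat"
  assumes splits: "hermitian_splits TYPE('a)" and M: "M \<in> poly_mats m q d" and pos: "0 < q" "0 < d"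
    and not_inj: "\<not> left_injective (coeff_mat M d)" and eps: "0 < \<epsilon>"
  shows "\<exists>M' \<in> poly_mats m q d. \<not> minimal_basis M' \<and>
    spectral_norm (sylvester d 1 M - sylvester d 1 M') < \<epsilon>"
proof -
  have Mc: "M \<in> carrier_mat m q" using M by (simp add: poly_mats_def)
  obtain v i0 where v: "\<And>j. j < q \<Longrightarrow> row_comb (coeff_mat M d) v j = 0" and i0: "i0 < m" "v i0 \<noteq> 0"
    using not_inj coeff_mat_carrier[OF M, of d] by (auto simp: left_injective_def)
  define P where "P j = row_comb M (\<lambda>i. [:v i:]) j" for j
  have const: "degree_less [:v i:] (Suc 0)" for i by (simp add: degree_less_iff)
  \<comment> \<open>The coefficient of \<open>P j\<close> at \<open>d\<close> is entry
    \<open>j\<close> of \<open>v M_d\<close>, hence zero.\<close>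
  have P: "degree_less (P j) d" if j: "j < q" for j
    unfolding degree_less_def
  proof (intro allI impI)
    fix l assume "d \<le> l"
    then consider "l = 0 + d" | "Suc 0 + d \<le> l" by force
    then show "coeff (P j) l = 0"
    proof cases
      case 1
      then show ?thesis
        using coeff_row_comb_top[OF M _ j, of "\<lambda>i. [:v i:]" 0] const v[OF j] by (simp add: P_def)
    next
      case 2
      then show ?thesis
        using degree_less_row_comb[OF M _ j, of "\<lambda>i. [:v i:]" "Suc 0"] const
        by (simp add: P_def degree_less_def)
    qed
  qed
  define \<kappa> where "\<kappa> j = (\<Sum>l<d. norm (coeff (P j) l)) / norm (v i0)" for j
  define K where "K = (\<Sum>j<q. (\<kappa> j)\<^sup>2)"
  have K: "0 \<le> K" unfolding K_def by (intro sum_nonneg) auto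
  \<comment> \<open>Since \<open>\<kappa> j / T\<close> bounds \<open>c j\<close>, the perturbation
    has length at most \<open>sqrt K / T\<close>. The summand 1 makes this strictly less than
    \<open>\<epsilon>\<close> and gives \<open>T >= 1\<close>.\<close>
  define T where "T = 1 + sqrt K / \<epsilon>"
  have T: "1 \<le> T" using K eps by (simp add: T_def)
  define t :: 'a where "t = of_real T"
  have t: "t \<noteq> 0" "norm t = T" using T by (auto simp: t_def)
  define c where "c j = poly (P j) t / (v i0 * t ^ d)" for j
  have "norm (c j) \<le> \<kappa> j / T" if j: "j < q" for j
  proof -
    have "norm (c j) = norm (poly (P j) t) / (norm (v i0) * T ^ d)"
      by (simp add: c_def norm_divide norm_mult norm_power t)
    also have "\<dots> \<le> (\<Sum>l<d. norm (coeff (P j) l)) * T ^ (d - 1) / (norm (v i0) * T ^ d)"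
      unfolding t_def using norm_poly_of_real_le[OF P[OF j] pos(2) T] T
      by (intro divide_right_mono) auto
    also have "T ^ d = T * T ^ (d - 1)" using pos by (simp flip: power_Suc)
    finally show ?thesis using T by (simp add: \<kappa>_def mult_ac)
  qed
  then have "(\<Sum>j<q. (norm (c j))\<^sup>2) \<le> (\<Sum>j<q. (\<kappa> j / T)\<^sup>2)"
    by (intro sum_mono power_mono) auto
  also have "\<dots> = K / T\<^sup>2"
    unfolding K_def by (simp only: sum_divide_distrib power_divide)
  also have "\<dots> < \<epsilon>\<^sup>2"
  proof -
    have "sqrt K < \<epsilon> * T" using eps by (simp add: T_def distrib_left)
    then have "(sqrt K)\<^sup>2 < (\<epsilon> * T)\<^sup>2" using K by (intro power_strict_mono) auto
    then show ?thesis using K T by (simp add: power_mult_distrib pos_divide_less_eq)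
  qed
  finally have c_small: "(\<Sum>j<q. (norm (c j))\<^sup>2) < \<epsilon>\<^sup>2" .
  define C where "C = mat m q (\<lambda>(i, j). if i = i0 then monom (c j) d else 0)"
  define M' where "M' = M - C"
  have C: "C \<in> poly_mats m q d"
    by (auto simp: C_def poly_mats_def degree_monom_le)
  then have Cc: "C \<in> carrier_mat m q" by (simp add: poly_mats_def)
  have M': "M' \<in> poly_mats m q d" unfolding M'_def using M C by (rule poly_mats_diff)
  have "poly (row_comb M' (\<lambda>i. [:v i:]) j) t = 0" if j: "j < q" for j
  proof -
    have "row_comb C (\<lambda>i. [:v i:]) j = (\<Sum>i<m. if i = i0 then [:v i0:] * monom (c j) d else 0)"
      unfolding row_comb_def using Cc j by (intro sum.cong) (auto simp: C_def)
    then have "row_comb C (\<lambda>i. [:v i:]) j = [:v i0:] * monom (c j) d" using i0 by simp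
    then show ?thesis
      unfolding M'_def row_comb_diff[OF Mc Cc j] P_def[symmetric]
      using t i0 by (simp add: poly_monom c_def)
  qed
  then have "\<not> minimal_basis M'"
    using M' i0 by (intro not_minimal_basis_of_zero[of M' m q i0 v t]) (auto simp: poly_mats_def)
  moreover have "spectral_norm (sylvester d 1 M - sylvester d 1 M') < \<epsilon>"
  proof -
    have M'c: "M' \<in> carrier_mat m q" using M' by (simp add: poly_mats_def)
    have "M - M' = C"
      using Mc Cc by (intro eq_matI) (auto simp: M'_def)
    then have diff: "sylvester d 1 M - sylvester d 1 M' = sylvester d 1 C"
      using sylvester_diff[OF Mc M'c] by simp
    have S: "sylvester d 1 C \<in> carrier_mat ((1 + d) * m) (1 * q)"
      by (rule sylvester_carrier[OF Cc])
    \<comment> \<open>At most one row of \<open>S_1(C)\<close> is nonzero, the one for row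
      \<open>i0\<close> of the last block, and it carries the entries \<open>c j\<close>; thus the
      spectral norm is at most the length of \<open>c\<close>.\<close>
    have comb: "row_comb (sylvester d 1 C) y j = y (d * m + i0) * c j" if j: "j < q" for y j
    proof -
      have "row_comb (sylvester d 1 C) y j
          = (\<Sum>a<1 + d. \<Sum>i<m. y (a * m + i) * sylvester d 1 C $$ (a * m + i, 0 * q + j))"
        unfolding row_comb_def carrier_matD(1)[OF S] sum_lessThan_mult by (simp only: mult_0 add_0)
      also have "\<dots> = (\<Sum>a<1 + d. \<Sum>i<m. if a = d \<and> i = i0 then y (d * m + i0) * c j else 0)"
        by (intro sum.cong refl) (use sylvester_index[OF Cc, where k = 1 and b = 0] j in \<open>auto simp: C_def\<close>)
      also have "\<dots> = (\<Sum>a<1 + d. if a = d then y (d * m + i0) * c j else 0)"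
        using i0 by (intro sum.cong refl) auto
      finally show ?thesis by simp
    qed
    have "(\<Sum>j<1 * q. (norm (row_comb (sylvester d 1 C) y j))\<^sup>2)
        \<le> (\<Sum>j<q. (norm (c j))\<^sup>2) * (\<Sum>i<(1 + d) * m. (norm (y i))\<^sup>2)" for y
    proof -
      have "(\<Sum>j<1 * q. (norm (row_comb (sylvester d 1 C) y j))\<^sup>2)
          = (norm (y (d * m + i0)))\<^sup>2 * (\<Sum>j<q. (norm (c j))\<^sup>2)"
        unfolding sum_distrib_left by (intro sum.cong) (auto simp: comb[unfolded One_nat_def] norm_mult power_mult_distrib)
      also have "\<dots> \<le> (\<Sum>i<(1 + d) * m. (norm (y i))\<^sup>2) * (\<Sum>j<q. (norm (c j))\<^sup>2)"
        using mult_add_less[of d "1 + d" i0 m] i0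
        by (intro mult_right_mono member_le_sum sum_nonneg) auto
      finally show ?thesis by (simp only: mult.commute)
    qed
    then have "(spectral_norm (sylvester d 1 C))\<^sup>2 \<le> (\<Sum>j<q. (norm (c j))\<^sup>2)"
      using i0 pos by (intro spectral_norm_upper(3)[OF splits S]) auto
    then have "(spectral_norm (sylvester d 1 C))\<^sup>2 < \<epsilon>\<^sup>2" using c_small by simp
    then show ?thesis unfolding diff using eps by (rule power2_less_imp_less[OF _ less_imp_le])
  qed
  ultimately show ?thesis using M' by blast
qed

text \<open>Both fields are treated at once; the real and the complex case differ only in the proof
  of \<open>splits\<close>.\<close>

lemma minimal_basis_robustness:
  fixes M :: "'a::rc_field poly mat"
  assumes splits: "hermitian_splits TYPE('a)" and pos: "m > 0" "n > 0" "d > 0"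
    and M: "M \<in> poly_mats m (m + n) d" and min: "minimal_basis M"
  shows "(mat_rank (coeff_mat M d) < m \<longrightarrow>
         (\<forall>\<epsilon>>0. \<exists>M' \<in> poly_mats m (m + n) d.
            \<not> minimal_basis M' \<and>
            spectral_norm (sylvester d 1 M - sylvester d 1 M') < \<epsilon>)) \<and>
      (mat_rank (coeff_mat M d) = m \<longrightarrow>
         (\<exists>k\<ge>1. full_row_rank (sylvester d k M)) \<and>
         (\<forall>k\<ge>1. full_row_rank (sylvester d k M) \<longrightarrow>
            (\<forall>M' \<in> poly_mats m (m + n) d.
               spectral_norm (sylvester d 1 M - sylvester d 1 M')
                 < singular_value ((k + d) * m) (sylvester d k M) / sqrt (real k) \<longrightarrow>
               minimal_basis M' \<and> mat_rank (coeff_mat M' d) = m)))"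
proof (intro conjI impI)
  assume "mat_rank (coeff_mat M d) < m"
  then have "\<not> left_injective (coeff_mat M d)"
    using mat_rank_eq_dim_row_iff[OF coeff_mat_carrier[OF M]] by (metis less_irrefl)
  then show "\<forall>\<epsilon>>0. \<exists>M' \<in> poly_mats m (m + n) d. \<not> minimal_basis M' \<and>
      spectral_norm (sylvester d 1 M - sylvester d 1 M') < \<epsilon>"
    using nearby_not_minimal_basis[OF splits M] pos by simp
next
  assume "mat_rank (coeff_mat M d) = m"
  then have "left_injective (coeff_mat M d)"
    using mat_rank_eq_dim_row_iff[OF coeff_mat_carrier[OF M]] by metis
  \<comment> \<open>\<open>k = d m\<close> is the smallest index that the dimension count covers; it
    is positive as \<open>d\<close> and \<open>m\<close> are.\<close>
  then have "full_row_rank (sylvester d (d * m) M)"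
    unfolding full_row_rank_iff by (intro left_injective_sylvester[OF M min]) auto
  then show "\<exists>k\<ge>1. full_row_rank (sylvester d k M)"
    using pos by (intro exI[of _ "d * m"]) (simp add: Suc_le_eq)
next
  show "\<forall>k\<ge>1. full_row_rank (sylvester d k M) \<longrightarrow>
    (\<forall>M' \<in> poly_mats m (m + n) d.
       spectral_norm (sylvester d 1 M - sylvester d 1 M')
         < singular_value ((k + d) * m) (sylvester d k M) / sqrt (real k) \<longrightarrow>
       minimal_basis M' \<and> mat_rank (coeff_mat M' d) = m)"
  proof (intro allI impI ballI)
    fix k M' assume k: "1 \<le> k" and full: "full_row_rank (sylvester d k M)"
      and M': "M' \<in> poly_mats m (m + n) d"
      and less: "spectral_norm (sylvester d 1 M - sylvester d 1 M')
         < singular_value ((k + d) * m) (sylvester d k M) / sqrt (real k)"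
    have inj: "left_injective (sylvester d k M')"
      by (rule sylvester_perturbation[OF splits _ _ _ _ _ full less, where q = "m + n"])
        (use M M' pos k in \<open>auto simp: poly_mats_def\<close>)
    have "minimal_basis M'"
      using minimal_basis_of_sylvester[OF M' _ inj] pos k by simp
    moreover have "left_injective (coeff_mat M' d)"
      using left_injective_top_coeff_of_sylvester[OF M' inj] k by simp
    then have "mat_rank (coeff_mat M' d) = m"
      using mat_rank_eq_dim_row_iff[OF coeff_mat_carrier[OF M']] by metis
    ultimately show "minimal_basis M' \<and> mat_rank (coeff_mat M' d) = m" by blast
  qed
qed

theorem theorem6p3:
  fixes m n d :: nat
  assumes "m > 0" and "n > 0" and "d > 0"
  shows
    "(\<forall>M :: real poly mat. M \<in> poly_mats m (m + n) d \<longrightarrow> minimal_basis M \<longrightarrow>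
      (mat_rank (coeff_mat M d) < m \<longrightarrow>
         (\<forall>\<epsilon>>0. \<exists>M' \<in> poly_mats m (m + n) d.
            \<not> minimal_basis M' \<and>
            spectral_norm (sylvester d 1 M - sylvester d 1 M') < \<epsilon>)) \<and>
      (mat_rank (coeff_mat M d) = m \<longrightarrow>
         (\<exists>k\<ge>1. full_row_rank (sylvester d k M)) \<and>
         (\<forall>k\<ge>1. full_row_rank (sylvester d k M) \<longrightarrow>
            (\<forall>M' \<in> poly_mats m (m + n) d.
               spectral_norm (sylvester d 1 M - sylvester d 1 M')
                 < singular_value ((k + d) * m) (sylvester d k M) / sqrt (real k) \<longrightarrow>
               minimal_basis M' \<and> mat_rank (coeff_mat M' d) = m))))
     \<and>
     (\<forall>M :: complex poly mat. M \<in> poly_mats m (m + n) d \<longrightarrow> minimal_basis M \<longrightarrow>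
      (mat_rank (coeff_mat M d) < m \<longrightarrow>
         (\<forall>\<epsilon>>0. \<exists>M' \<in> poly_mats m (m + n) d.
            \<not> minimal_basis M' \<and>
            spectral_norm (sylvester d 1 M - sylvester d 1 M') < \<epsilon>)) \<and>
      (mat_rank (coeff_mat M d) = m \<longrightarrow>
         (\<exists>k\<ge>1. full_row_rank (sylvester d k M)) \<and>
         (\<forall>k\<ge>1. full_row_rank (sylvester d k M) \<longrightarrow>
            (\<forall>M' \<in> poly_mats m (m + n) d.
               spectral_norm (sylvester d 1 M - sylvester d 1 M')
                 < singular_value ((k + d) * m) (sylvester d k M) / sqrt (real k) \<longrightarrow>
               minimal_basis M' \<and> mat_rank (coeff_mat M' d) = m))))"
  using minimal_basis_robustness[OF hermitian_splits_real assms]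
    minimal_basis_robustness[OF hermitian_splits_complex assms]
  by blast

end
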